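(* If $(M,F)$ is a connected complex Finsler space of complex dimension $2$ with $R_{\bar rj\bar hk}=0$ and $|A|\neq0$ (i.e. $A$ not identically zero), then $\dot\partial_{\bar h}G^i=0$ for all $i,h\in\{1,2\}$.
   Context: $M$ is a complex manifold with $\dim_{\mathbb C}M=2$; $T'M$ is its holomorphic tangent bundle with local coordinates $(z^k,\eta^k)_{k=1,2}$; $\widetilde{T'M}$ is $T'M$ minus the zero section. A complex Finsler space $(M,F)$: $F:T'M\to[0,\infty)$ is continuous, $L:=F^2$ is smooth on $\widetilde{T'M}$, $F(z,\eta)=0$ iff $\eta=0$, $F(z,\lambda\eta)=|\lambda|F(z,\eta)$ for all $\lambda\in\mathbb C$, and the Hermitian matrix $g_{i\bar j}:=\partial^2L/\partial\eta^i\partial\bar\eta^j$ is positive definite on $\widetilde{T'M}$. "Connected" means $M$ is connected. Repeated indices are summed over $\{1,2\}$; everything lives on $\widetilde{T'M}$. $(g^{\bar m i})$ is the inverse matrix: $g^{\bar m i}g_{j\bar m}=\delta^i_j$. Chern–Finsler connection: $\dot\partial_k:=\partial/\partial\eta^k$, $\dot\partial_{\bar k}:=\partial/\partial\bar\eta^k$, $N^k_j:=g^{\bar mk}\frac{\partial g_{l\bar m}}{\partial z^j}\eta^l$, $\delta_k:=\frac{\partial}{\partial z^k}-N^j_k\dot\partial_j$, $\delta_{\bar k}:=\overline{\delta_k}$, $L^i_{jk}:=g^{\bar li}\delta_kg_{j\bar l}$, $C^i_{jk}:=g^{\bar li}\dot\partial_kg_{j\bar l}$. Curvature: $R^i_{j\bar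 hk}:=-\delta_{\bar h}L^i_{jk}-\delta_{\bar h}(N^l_k)C^i_{jl}$, $R_{\bar rj\bar hk}:=g_{i\bar r}R^i_{j\bar hk}$. Spray coefficients: $G^i:=\frac12N^i_j\eta^j$. In a fixed local chart: $l_i:=\frac1Fg_{i\bar j}\bar\eta^j$, $g:=\det(g_{i\bar j})$, $m^1:=-l_2/\sqrt g$, $m^2:=l_1/\sqrt g$, $A:=m^jm^kl_hC^h_{kj}$ ($|A|$ is independent of the chart; $A\equiv0$ means $g_{i\bar j}$ depends on $z$ only). *)

theory Defs
  imports "HOL-Analysis.Analysis"
begin

section \<open>Smooth and holomorphic maps\<close>

text \<open>For open \<open>S\<close> in a Euclidean space, \<open>Ck_on k f S\<close> is the usual class \<open>C\<^sup>k\<close>; derivatives are real.\<close>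

primrec Ck_on ::
  "nat \<Rightarrow> ('a::real_normed_vector \<Rightarrow> 'b::real_normed_vector) \<Rightarrow> 'a set \<Rightarrow> bool" where
  "Ck_on 0 f S \<longleftrightarrow> continuous_on S f"
| "Ck_on (Suc k) f S \<longleftrightarrow>
     f differentiable_on S \<and> (\<forall>v. Ck_on k (\<lambda>x. frechet_derivative f (at x) v) S)"

definition smooth_on ::
  "('a::real_normed_vector \<Rightarrow> 'b::real_normed_vector) \<Rightarrow> 'a set \<Rightarrow> bool" where
  "smooth_on f S \<longleftrightarrow> (\<forall>k. Ck_on k f S)"

definition holomorphic_map_on :: "(complex^'n \<Rightarrow> complex^'m) \<Rightarrow> (complex^'n) set \<Rightarrow> bool" where
  "holomorphic_map_on f S \<longleftrightarrow>
     (\<forall>x\<in>S. \<exists>D. (f has_derivative D) (at x) \<and> (\<forall>c v. D (c *s v) = c *s D v))"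

section \<open>Complex manifolds and the holomorphic tangent bundle\<close>

text \<open>A chart is a pair \<open>(U, \<phi>)\<close>; only the values of \<open>\<phi>\<close> on \<open>U\<close> are relevant.\<close>

type_synonym ('a, 'n) chart = "'a set \<times> ('a \<Rightarrow> complex^'n)"

definition transition :: "('a, 'n) chart \<Rightarrow> ('a, 'n) chart \<Rightarrow> complex^'n \<Rightarrow> complex^'n" where
  "transition c d = snd d \<circ> inv_into (fst c) (snd c)"

definition complex_manifold :: "'a topology \<Rightarrow> ('a, 'n::finite) chart set \<Rightarrow> bool" where
  "complex_manifold M \<A> \<longleftrightarrow>
     Hausdorff_space M \<and> second_countable M \<and>
     (\<Union>c\<in>\<A>. fst c) = topspace M \<and>
     (\<forall>(U, \<phi>)\<in>\<A>. openin M U \<and> open (\<phi> ` U) \<and>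
        homeomorphic_map (subtopology M U) (top_of_set (\<phi> ` U)) \<phi>) \<and>
     (\<forall>c\<in>\<A>. \<forall>d\<in>\<A>. holomorphic_map_on (transition c d) (snd c ` (fst c \<inter> fst d)))"

definition charts_at :: "('a, 'n) chart set \<Rightarrow> 'a \<Rightarrow> ('a, 'n) chart set" where
  "charts_at \<A> p = {c\<in>\<A>. p \<in> fst c}"

definition transition_deriv ::
  "('a, 'n::finite) chart \<Rightarrow> ('a, 'n) chart \<Rightarrow> 'a \<Rightarrow> complex^'n \<Rightarrow> complex^'n" where
  "transition_deriv c d p = frechet_derivative (transition c d) (at (snd c p))"

text \<open>
  A holomorphic tangent vector at \<open>p\<close> is encoded by the family of its coordinate vectors
  \<open>(\<eta>\<^sup>k)\<close> in all charts around \<open>p\<close>, which transform by the differentials of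
  the coordinate changes; it is \<open>undefined\<close> on the other charts.
  The fibre of \<open>T'M\<close> over \<open>p\<close> is \<open>tangent_space \<A> p\<close>.
\<close>

type_synonym ('a, 'n) tvec = "('a, 'n) chart \<Rightarrow> complex^'n"

definition tangent_space :: "('a, 'n::finite) chart set \<Rightarrow> 'a \<Rightarrow> ('a, 'n) tvec set" where
  "tangent_space \<A> p =
     {v \<in> extensional (charts_at \<A> p).
        \<forall>c\<in>charts_at \<A> p. \<forall>d\<in>charts_at \<A> p. v d = transition_deriv c d p (v c)}"

definition tvec_zero :: "('a, 'n::finite) chart set \<Rightarrow> 'a \<Rightarrow> ('a, 'n) tvec" where
  "tvec_zero \<A> p = restrict (\<lambda>c. 0) (charts_at \<A> p)"

definition tvec_scale ::
  "('a, 'n::finite) chart set \<Rightarrow> 'a \<Rightarrow> complex \<Rightarrow> ('a, 'n) tvec \<Rightarrow> ('a, 'n) tvec" where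
  "tvec_scale \<A> p a v = restrict (\<lambda>c. a *s v c) (charts_at \<A> p)"

definition tvec_of_coords ::
  "('a, 'n::finite) chart set \<Rightarrow> ('a, 'n) chart \<Rightarrow> 'a \<Rightarrow> complex^'n \<Rightarrow> ('a, 'n) tvec" where
  "tvec_of_coords \<A> c p \<eta> = restrict (\<lambda>d. transition_deriv c d p \<eta>) (charts_at \<A> p)"

text \<open>
  The expression of a function on \<open>T'M\<close> in the local coordinates \<open>(z, \<eta>)\<close> induced by the
  chart \<open>c\<close>, and the coordinate domains of \<open>T'M\<close> and of \<open>T'M\<close> minus the zero section.
\<close>

definition in_chart :: "('a, 'n::finite) chart set \<Rightarrow> ('a \<Rightarrow> ('a, 'n) tvec \<Rightarrow> real) \<Rightarrow>
    ('a, 'n) chart \<Rightarrow> (complex^'n) \<times> (complex^'n) \<Rightarrow> real" where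
  "in_chart \<A> F c = (\<lambda>(z, \<eta>).
     let p = inv_into (fst c) (snd c) z in F p (tvec_of_coords \<A> c p \<eta>))"

definition bundle_dom :: "('a, 'n) chart \<Rightarrow> ((complex^'n) \<times> (complex^'n)) set" where
  "bundle_dom c = (snd c ` fst c) \<times> UNIV"

definition slit_dom :: "('a, 'n) chart \<Rightarrow> ((complex^'n) \<times> (complex^'n)) set" where
  "slit_dom c = (snd c ` fst c) \<times> (UNIV - {0})"

section \<open>Wirtinger derivatives in the coordinates \<open>(z, \<eta>)\<close>\<close>

definition d_z :: "'n::finite \<Rightarrow> ((complex^'n) \<times> (complex^'n) \<Rightarrow> complex) \<Rightarrow>
    (complex^'n) \<times> (complex^'n) \<Rightarrow> complex" where
  "d_z k f p = (frechet_derivative f (at p) (axis k 1, 0)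
                - \<i> * frechet_derivative f (at p) (axis k \<i>, 0)) / 2"

definition d_zbar :: "'n::finite \<Rightarrow> ((complex^'n) \<times> (complex^'n) \<Rightarrow> complex) \<Rightarrow>
    (complex^'n) \<times> (complex^'n) \<Rightarrow> complex" where
  "d_zbar k f p = (frechet_derivative f (at p) (axis k 1, 0)
                   + \<i> * frechet_derivative f (at p) (axis k \<i>, 0)) / 2"

definition d_eta :: "'n::finite \<Rightarrow> ((complex^'n) \<times> (complex^'n) \<Rightarrow> complex) \<Rightarrow>
    (complex^'n) \<times> (complex^'n) \<Rightarrow> complex" where
  "d_eta k f p = (frechet_derivative f (at p) (0, axis k 1)
                  - \<i> * frechet_derivative f (at p) (0, axis k \<i>)) / 2"

definition d_etabar :: "'n::finite \<Rightarrow> ((complex^'n) \<times> (complex^'n) \<Rightarrow> complex) \<Rightarrow>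
    (complex^'n) \<times> (complex^'n) \<Rightarrow> complex" where
  "d_etabar k f p = (frechet_derivative f (at p) (0, axis k 1)
                     + \<i> * frechet_derivative f (at p) (0, axis k \<i>)) / 2"

section \<open>Chern--Finsler connection, curvature and spray in local coordinates\<close>

text \<open>
  Here \<open>f\<close> is the coordinate expression of the Finsler function \<open>F\<close>.  Index conventions:
  \<open>metric f i j\<close> is \<open>g\<close> with indices \<open>i, bar j\<close>; \<open>metric_inv f m i\<close> is the inverse
  with indices \<open>bar m, i\<close>; for \<open>N\<close>, \<open>L\<close>, \<open>C\<close>, \<open>R\<close>, \<open>G\<close> the upper index comes first and
  the lower indices follow in their written order.
\<close>

type_synonym 'n bundle_fun = "(complex^'n) \<times> (complex^'n) \<Rightarrow> complex"

definition metric :: "((complex^'n) \<times> (complex^'n) \<Rightarrow> real) \<Rightarrow> 'n::finite \<Rightarrow> 'n \<Rightarrow> 'n bundle_fun" where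
  "metric f i j = d_eta i (d_etabar j (\<lambda>p. complex_of_real ((f p)\<^sup>2)))"

definition metric_mat ::
  "((complex^'n) \<times> (complex^'n) \<Rightarrow> real) \<Rightarrow> (complex^'n) \<times> (complex^'n) \<Rightarrow> complex^'n^'n::finite" where
  "metric_mat f p = (\<chi> i j. metric f i j p)"

definition metric_inv :: "((complex^'n) \<times> (complex^'n) \<Rightarrow> real) \<Rightarrow> 'n::finite \<Rightarrow> 'n \<Rightarrow> 'n bundle_fun" where
  "metric_inv f m i p = matrix_inv (metric_mat f p) $ m $ i"

definition nonlin_conn :: "((complex^'n) \<times> (complex^'n) \<Rightarrow> real) \<Rightarrow> 'n::finite \<Rightarrow> 'n \<Rightarrow> 'n bundle_fun" where
  "nonlin_conn f k j p =
     (\<Sum>m\<in>UNIV. \<Sum>l\<in>UNIV. metric_inv f m k p * d_z j (metric f l m) p * snd p $ l)"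

definition delta :: "((complex^'n) \<times> (complex^'n) \<Rightarrow> real) \<Rightarrow> 'n::finite \<Rightarrow> 'n bundle_fun \<Rightarrow> 'n bundle_fun" where
  "delta f k u p = d_z k u p - (\<Sum>j\<in>UNIV. nonlin_conn f j k p * d_eta j u p)"

definition delta_bar :: "((complex^'n) \<times> (complex^'n) \<Rightarrow> real) \<Rightarrow> 'n::finite \<Rightarrow> 'n bundle_fun \<Rightarrow> 'n bundle_fun" where
  "delta_bar f k u p = d_zbar k u p - (\<Sum>j\<in>UNIV. cnj (nonlin_conn f j k p) * d_etabar j u p)"

definition conn_L :: "((complex^'n) \<times> (complex^'n) \<Rightarrow> real) \<Rightarrow> 'n::finite \<Rightarrow> 'n \<Rightarrow> 'n \<Rightarrow> 'n bundle_fun" where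
  "conn_L f i j k p = (\<Sum>l\<in>UNIV. metric_inv f l i p * delta f k (metric f j l) p)"

definition conn_C :: "((complex^'n) \<times> (complex^'n) \<Rightarrow> real) \<Rightarrow> 'n::finite \<Rightarrow> 'n \<Rightarrow> 'n \<Rightarrow> 'n bundle_fun" where
  "conn_C f i j k p = (\<Sum>l\<in>UNIV. metric_inv f l i p * d_eta k (metric f j l) p)"

definition curv :: "((complex^'n) \<times> (complex^'n) \<Rightarrow> real) \<Rightarrow> 'n::finite \<Rightarrow> 'n \<Rightarrow> 'n \<Rightarrow> 'n \<Rightarrow> 'n bundle_fun" where
  "curv f i j h k p =
     - delta_bar f h (conn_L f i j k) p
     - (\<Sum>l\<in>UNIV. delta_bar f h (nonlin_conn f l k) p * conn_C f i j l p)"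

definition curv_low :: "((complex^'n) \<times> (complex^'n) \<Rightarrow> real) \<Rightarrow> 'n::finite \<Rightarrow> 'n \<Rightarrow> 'n \<Rightarrow> 'n \<Rightarrow> 'n bundle_fun" where
  "curv_low f r j h k p = (\<Sum>i\<in>UNIV. metric f i r p * curv f i j h k p)"

definition spray :: "((complex^'n) \<times> (complex^'n) \<Rightarrow> real) \<Rightarrow> 'n::finite \<Rightarrow> 'n bundle_fun" where
  "spray f i p = (\<Sum>j\<in>UNIV. nonlin_conn f i j p * snd p $ j) / 2"

definition covec_l :: "((complex^'n) \<times> (complex^'n) \<Rightarrow> real) \<Rightarrow> 'n::finite \<Rightarrow> 'n bundle_fun" where
  "covec_l f i p = (\<Sum>j\<in>UNIV. metric f i j p * cnj (snd p $ j)) / complex_of_real (f p)"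

text \<open>
  The determinant of the metric is a positive real number, so \<open>csqrt\<close> is its positive root.
  The elements of the index type \<open>2\<close> are \<open>1\<close> and \<open>2\<close> (with \<open>2 = 0\<close>).
\<close>

definition vec_m :: "((complex^2) \<times> (complex^2) \<Rightarrow> real) \<Rightarrow> 2 \<Rightarrow> 2 bundle_fun" where
  "vec_m f i p = (if i = 1 then - covec_l f 2 p else covec_l f 1 p) / csqrt (det (metric_mat f p))"

definition A_coef :: "((complex^2) \<times> (complex^2) \<Rightarrow> real) \<Rightarrow> 2 bundle_fun" where
  "A_coef f p = (\<Sum>j\<in>UNIV. \<Sum>k\<in>UNIV. \<Sum>h\<in>UNIV.
     vec_m f j p * vec_m f k p * covec_l f h p * conn_C f h k j p)"

section \<open>Complex Finsler spaces\<close>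

text \<open>
  Continuity on \<open>T'M\<close> and smoothness off the zero section are stated in the induced
  coordinates of \<open>T'M\<close>, which define its topology and smooth structure.
\<close>

definition complex_finsler_space ::
  "'a topology \<Rightarrow> ('a, 'n::finite) chart set \<Rightarrow> ('a \<Rightarrow> ('a, 'n) tvec \<Rightarrow> real) \<Rightarrow> bool" where
  "complex_finsler_space M \<A> F \<longleftrightarrow>
     complex_manifold M \<A> \<and>
     (\<forall>p\<in>topspace M. \<forall>v\<in>tangent_space \<A> p.
        F p v \<ge> 0 \<and>
        (F p v = 0 \<longleftrightarrow> v = tvec_zero \<A> p) \<and>
        (\<forall>a. F p (tvec_scale \<A> p a v) = cmod a * F p v)) \<and>
     (\<forall>c\<in>\<A>. continuous_on (bundle_dom c) (in_chart \<A> F c)) \<and>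
     (\<forall>c\<in>\<A>. smooth_on (\<lambda>q. (in_chart \<A> F c q)\<^sup>2) (slit_dom c)) \<and>
     (\<forall>c\<in>\<A>. \<forall>q\<in>slit_dom c. \<forall>\<zeta>::complex^'n. \<zeta> \<noteq> 0 \<longrightarrow>
        (let s = (\<Sum>i\<in>UNIV. \<Sum>j\<in>UNIV. metric (in_chart \<A> F c) i j q * \<zeta> $ i * cnj (\<zeta> $ j))
         in s \<in> \<real> \<and> 0 < Re s))"

end

theory Submission
  imports Defs
begin

text \<open>
  Write \<open>\<delta>'\<^sub>h\<close> for the conjugate of \<open>\<delta>\<^sub>h\<close>.  Contracting the curvature with \<open>\<eta>\<^sup>j\<close> turns flatness
  into \<open>\<delta>'\<^sub>h N = 0\<close>, and then also \<open>\<delta>'\<^sub>h L\<^sup>i\<^sub>j\<^sub>k = 0\<close>.  Since \<open>L\<^sup>i\<^sub>j\<^sub>k\<close> is the \<open>\<eta>\<^sup>j\<close>-derivative of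
  \<open>N\<^sup>i\<^sub>k\<close>, commuting that derivative with \<open>\<delta>'\<^sub>h\<close> shows that the matrices \<open>P\<^sub>k\<close> of the derivatives of
  \<open>N\<^sup>i\<^sub>k\<close> with respect to the conjugate of \<open>\<eta>\<^sup>l\<close> satisfy \<open>P\<^sub>k (cnj P\<^sub>h) = 0\<close>.  Lowering the upper
  index of \<open>P\<^sub>k\<close> with the metric gives a symmetric matrix, so \<open>P\<^sub>k (cnj P\<^sub>k) = 0\<close> says that the columns
  of \<open>P\<^sub>k\<close> have length zero.  Thus \<open>N\<close>, and with it the spray, is holomorphic in \<open>\<eta>\<close>.
\<close>

section \<open>Smooth functions\<close>

text \<open>The direction precedes the point, so that fixing it gives an operator on functions that
  can be iterated as in \<open>Ck_on\<close>.\<close>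

abbreviation dir_deriv ::
  "('a::real_normed_vector \<Rightarrow> 'b::real_normed_vector) \<Rightarrow> 'a \<Rightarrow> 'a \<Rightarrow> 'b" where
  "dir_deriv f v \<equiv> \<lambda>x. frechet_derivative f (at x) v"

lemma dir_deriv_eq: "(f has_derivative D) (at x) \<Longrightarrow> dir_deriv f v x = D v"
  by (simp flip: frechet_derivative_at)

text \<open>\<open>frechet_derivative\<close> is a Hilbert choice among all derivatives at the
  point. Functions that agree near the point have the same derivatives, hence the same choice, even
  where no derivative exists.\<close>

lemma dir_deriv_cong:
  assumes "open S" "x \<in> S" "\<And>y. y \<in> S \<Longrightarrow> f y = g y"
  shows "dir_deriv f v x = dir_deriv g v x"
proof -
  have "(f has_derivative D) (at x) \<longleftrightarrow> (g has_derivative D) (at x)" for D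
    using assms has_derivative_transform_within_open[of f D x UNIV S g]
      has_derivative_transform_within_open[of g D x UNIV S f] by auto
  then show ?thesis by (simp add: frechet_derivative_def)
qed

lemma differentiable_at_cong_open:
  assumes "open S" "x \<in> S" "\<And>y. y \<in> S \<Longrightarrow> f y = g y" "f differentiable (at x)"
  shows "g differentiable (at x)"
proof -
  obtain D where "(f has_derivative D) (at x)" using assms(4) by (auto simp: differentiable_def)
  then have "(g has_derivative D) (at x)"
    by (rule has_derivative_transform_within_open) (use assms in auto)
  then show ?thesis by (rule differentiableI)
qed

lemma differentiable_on_open_at:
  "f differentiable_on S \<Longrightarrow> open S \<Longrightarrow> x \<in> S \<Longrightarrow> f differentiable (at x)"
  by (metis differentiable_on_def at_within_open)

section \<open>Closure properties of the classes C^k\<close>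

lemma Ck_on_cong:
  assumes "open S" "\<And>x. x \<in> S \<Longrightarrow> f x = g x" "Ck_on k f S"
  shows "Ck_on k g S"
  using assms(2,3)
proof (induction k arbitrary: f g)
  case 0
  then show ?case using continuous_on_cong[of S S f g] by simp
next
  case (Suc k)
  have f: "f differentiable_on S" "Ck_on k (dir_deriv f v) S" for v using Suc.prems(2) by simp_all
  have "g differentiable_on S"
    using differentiable_at_cong_open[OF assms(1) _ Suc.prems(1)
        differentiable_on_open_at[OF f(1) assms(1)]]
    by (rule differentiable_at_imp_differentiable_on)
  moreover have "Ck_on k (dir_deriv g v) S" for v
    by (rule Suc.IH[OF _ f(2)], rule dir_deriv_cong[OF assms(1)]) (use Suc.prems(1) in auto)
  ultimately show ?case by simp
qed

text \<open>Lets the derivative be supplied by an explicit formula \<open>D\<close>, as the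
  differentiation rules produce it, instead of by \<open>frechet_derivative\<close>.\<close>

lemma Ck_on_SucI:
  assumes "open S" "\<And>x. x \<in> S \<Longrightarrow> (f has_derivative D x) (at x)" "\<And>v. Ck_on k (\<lambda>x. D x v) S"
  shows "Ck_on (Suc k) f S"
proof -
  have "Ck_on k (dir_deriv f v) S" for v
    by (rule Ck_on_cong[OF assms(1) _ assms(3)]) (simp add: dir_deriv_eq[OF assms(2)])
  moreover have "f differentiable_on S"
    by (rule differentiable_at_imp_differentiable_on[OF differentiableI[OF assms(2)]])
  ultimately show ?thesis by simp
qed

lemma Ck_on_Suc_has_derivative:
  "Ck_on (Suc k) f S \<Longrightarrow> open S \<Longrightarrow> x \<in> S \<Longrightarrow> (f has_derivative (\<lambda>v. dir_deriv f v x)) (at x)"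
  using differentiable_on_open_at[of f S x] by (simp flip: frechet_derivative_works)

lemma Ck_on_Suc_dir_deriv: "Ck_on (Suc k) f S \<Longrightarrow> Ck_on k (dir_deriv f v) S"
  by simp

lemma Ck_on_SucD: "Ck_on (Suc k) f S \<Longrightarrow> Ck_on k f S"
  by (induction k arbitrary: f) (auto intro: differentiable_imp_continuous_on)

lemma Ck_on_const: "Ck_on k (\<lambda>x. c) S"
  by (induction k arbitrary: c) auto

lemma Ck_on_bounded_linear:
  assumes "open S" "bounded_linear h" "Ck_on k f S"
  shows "Ck_on k (\<lambda>x. h (f x)) S"
  using assms(3)
proof (induction k arbitrary: f)
  case 0
  then show ?case
    using linear_continuous_on[OF assms(2)] continuous_on_compose2[of UNIV h S f] by simp
next
  case (Suc k)
  show ?case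
    by (rule Ck_on_SucI[OF assms(1)
          bounded_linear.has_derivative[OF assms(2) Ck_on_Suc_has_derivative[OF Suc.prems assms(1)]]
          Suc.IH[OF Ck_on_Suc_dir_deriv[OF Suc.prems]]])
qed

lemma Ck_on_add:
  assumes "open S" "Ck_on k f S" "Ck_on k g S"
  shows "Ck_on k (\<lambda>x. f x + g x) S"
  using assms(2,3)
proof (induction k arbitrary: f g)
  case 0
  then show ?case by (simp add: continuous_on_add)
next
  case (Suc k)
  note D = Ck_on_Suc_has_derivative[OF _ assms(1)]
  show ?case
    by (rule Ck_on_SucI[OF assms(1) has_derivative_add[OF D[OF Suc.prems(1)] D[OF Suc.prems(2)]]
          Suc.IH[OF Suc.prems[THEN Ck_on_Suc_dir_deriv]]])
qed

text \<open>Each term of the product rule keeps one factor undifferentiated;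
  \<open>Ck_on_SucD\<close> lowers its order so that the induction hypothesis applies.\<close>

lemma Ck_on_mult:
  fixes f g :: "'a::real_normed_vector \<Rightarrow> 'b::real_normed_algebra"
  assumes "open S" "Ck_on k f S" "Ck_on k g S"
  shows "Ck_on k (\<lambda>x. f x * g x) S"
  using assms(2,3)
proof (induction k arbitrary: f g)
  case 0
  then show ?case by (simp add: continuous_on_mult)
next
  case (Suc k)
  note D = Ck_on_Suc_has_derivative[OF _ assms(1)]
  show ?case
    by (rule Ck_on_SucI[OF assms(1) has_derivative_mult[OF D[OF Suc.prems(1)] D[OF Suc.prems(2)]]
          Ck_on_add[OF assms(1)
            Suc.IH[OF Ck_on_SucD[OF Suc.prems(1)] Ck_on_Suc_dir_deriv[OF Suc.prems(2)]]
            Suc.IH[OF Ck_on_Suc_dir_deriv[OF Suc.prems(1)] Ck_on_SucD[OF Suc.prems(2)]]]])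
qed

text \<open>The derivative of 1/f is -(1/f) f' (1/f). It contains 1/f itself, which the induction
  hypothesis provides at the lower order.\<close>

lemma Ck_on_inverse:
  fixes f :: "'a::real_normed_vector \<Rightarrow> 'b::real_normed_field"
  assumes "open S" "\<And>x. x \<in> S \<Longrightarrow> f x \<noteq> 0" "Ck_on k f S"
  shows "Ck_on k (\<lambda>x. inverse (f x)) S"
  using assms(3)
proof (induction k)
  case 0
  then show ?case using assms(2) by (simp add: continuous_on_inverse)
next
  case (Suc k)
  note IH = Suc.IH[OF Ck_on_SucD[OF Suc.prems]]
  show ?case
    by (rule Ck_on_SucI[OF assms(1)
          Deriv.has_derivative_inverse[OF assms(2) Ck_on_Suc_has_derivative[OF Suc.prems assms(1)]]
          Ck_on_bounded_linear[OF assms(1) bounded_linear_minus[OF bounded_linear_ident]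
            Ck_on_mult[OF assms(1) Ck_on_mult[OF assms(1) IH Ck_on_Suc_dir_deriv[OF Suc.prems]] IH]]])
qed

section \<open>Closure properties of smooth functions\<close>

lemma smooth_on_has_derivative:
  "smooth_on f S \<Longrightarrow> open S \<Longrightarrow> x \<in> S \<Longrightarrow> (f has_derivative (\<lambda>v. dir_deriv f v x)) (at x)"
  by (rule Ck_on_Suc_has_derivative[of 0]) (simp_all add: smooth_on_def del: Ck_on.simps)

lemma smooth_on_differentiable_at:
  "smooth_on f S \<Longrightarrow> open S \<Longrightarrow> x \<in> S \<Longrightarrow> f differentiable (at x)"
  by (rule differentiableI[OF smooth_on_has_derivative])

lemma smooth_on_dir_deriv: "smooth_on f S \<Longrightarrow> smooth_on (dir_deriv f v) S"
  unfolding smooth_on_def by (intro allI Ck_on_Suc_dir_deriv) simp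

lemma smooth_on_cong:
  "open S \<Longrightarrow> (\<And>x. x \<in> S \<Longrightarrow> f x = g x) \<Longrightarrow> smooth_on f S \<Longrightarrow> smooth_on g S"
  unfolding smooth_on_def using Ck_on_cong by blast

lemma smooth_on_const: "smooth_on (\<lambda>x. c) S"
  by (simp add: smooth_on_def Ck_on_const)

lemma smooth_on_add:
  "open S \<Longrightarrow> smooth_on f S \<Longrightarrow> smooth_on g S \<Longrightarrow> smooth_on (\<lambda>x. f x + g x) S"
  by (simp add: smooth_on_def Ck_on_add)

lemma smooth_on_mult:
  fixes f g :: "'a::real_normed_vector \<Rightarrow> 'b::real_normed_algebra"
  shows "open S \<Longrightarrow> smooth_on f S \<Longrightarrow> smooth_on g S \<Longrightarrow> smooth_on (\<lambda>x. f x * g x) S"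
  by (simp add: smooth_on_def Ck_on_mult)

lemma smooth_on_bounded_linear:
  "open S \<Longrightarrow> bounded_linear h \<Longrightarrow> smooth_on f S \<Longrightarrow> smooth_on (\<lambda>x. h (f x)) S"
  by (simp add: smooth_on_def Ck_on_bounded_linear)

lemma smooth_on_ident: "smooth_on (\<lambda>x. x) S"
proof -
  have "Ck_on k (\<lambda>x. x) S" for k
    by (cases k) (auto simp: Ck_on_const)
  then show ?thesis by (simp add: smooth_on_def)
qed

lemma smooth_on_inverse:
  fixes f :: "'a::real_normed_vector \<Rightarrow> 'b::real_normed_field"
  shows "open S \<Longrightarrow> (\<And>x. x \<in> S \<Longrightarrow> f x \<noteq> 0) \<Longrightarrow> smooth_on f S \<Longrightarrow> smooth_on (\<lambda>x. inverse (f x)) S"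
  by (simp add: smooth_on_def Ck_on_inverse)

lemma smooth_on_diff:
  assumes "open S" "smooth_on f S" "smooth_on g S"
  shows "smooth_on (\<lambda>x. f x - g x) S"
  using smooth_on_add[OF assms(1,2) smooth_on_bounded_linear[OF assms(1)
      bounded_linear_minus[OF bounded_linear_ident] assms(3)]]
  by simp

lemma smooth_on_divide:
  fixes f g :: "'a::real_normed_vector \<Rightarrow> 'b::real_normed_field"
  assumes "open S" "\<And>x. x \<in> S \<Longrightarrow> g x \<noteq> 0" "smooth_on f S" "smooth_on g S"
  shows "smooth_on (\<lambda>x. f x / g x) S"
  using smooth_on_mult[OF assms(1,3) smooth_on_inverse[OF assms(1,2,4)]]
  by (simp add: divide_inverse)

lemma smooth_on_sum:
  "open S \<Longrightarrow> (\<And>i. i \<in> I \<Longrightarrow> smooth_on (f i) S) \<Longrightarrow> smooth_on (\<lambda>x. \<Sum>i\<in>I. f i x) S"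
  by (induction I rule: infinite_finite_induct) (auto simp: smooth_on_const smooth_on_add)

lemma smooth_on_prod:
  fixes f :: "'i \<Rightarrow> 'a::real_normed_vector \<Rightarrow> 'b::real_normed_field"
  shows "open S \<Longrightarrow> (\<And>i. i \<in> I \<Longrightarrow> smooth_on (f i) S) \<Longrightarrow> smooth_on (\<lambda>x. \<Prod>i\<in>I. f i x) S"
  by (induction I rule: infinite_finite_induct) (auto simp: smooth_on_const smooth_on_mult)

text \<open>Both sides are limits of the same second-order difference quotient, by the mean value theorem.\<close>

lemma dir_deriv_commute_real:
  fixes f :: "'a::real_normed_vector \<Rightarrow> real"
  assumes S: "open S" "p \<in> S" and f: "smooth_on f S"
  shows "dir_deriv (dir_deriv f a) b p = dir_deriv (dir_deriv f b) a p"
proof -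
  obtain e where e: "e > 0" "ball p e \<subseteq> S" using S openE by blast
  \<comment> \<open>Coefficients in \<open>[0, r)\<close> keep the combination of \<open>a\<close>
    and \<open>b\<close> shorter than \<open>e\<close>; the summand \<open>1\<close> keeps the
    denominator positive if both vectors vanish.\<close>
  define r where "r = e / (1 + norm a + norm b)"
  have ab: "1 + norm a + norm b > 0" by (simp add: add_pos_nonneg)
  then have r: "r > 0" unfolding r_def using e by simp
  have inS: "p + s *\<^sub>R a + t *\<^sub>R b \<in> S" if "0 \<le> s" "s < r" "0 \<le> t" "t < r" for s t
  proof -
    have "norm (s *\<^sub>R a + t *\<^sub>R b) \<le> s * norm a + t * norm b"
      using norm_triangle_ineq[of "s *\<^sub>R a" "t *\<^sub>R b"] that by simp
    also have "\<dots> \<le> r * norm a + r * norm b" using that by (intro add_mono mult_right_mono) auto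
    also have "\<dots> < r * (1 + norm a + norm b)" using r by (simp add: algebra_simps)
    also have "\<dots> = e" unfolding r_def using ab by simp
    finally have "p + (s *\<^sub>R a + t *\<^sub>R b) \<in> ball p e"
      by (metis mem_ball dist_norm norm_minus_commute add_diff_cancel_left')
    then show ?thesis using e(2) by (metis add.assoc subsetD)
  qed
  have curve: "((\<lambda>s. g (q + s *\<^sub>R v)) has_derivative (\<lambda>h. h * dir_deriv g v (q + s *\<^sub>R v))) (at s)"
    if "smooth_on g S" "q + s *\<^sub>R v \<in> S" for g :: "'a \<Rightarrow> real" and q v s
  proof -
    have 1: "((\<lambda>s. q + s *\<^sub>R v) has_derivative (\<lambda>h. h *\<^sub>R v)) (at s)"
      by (auto intro!: derivative_eq_intros)
    have 2: "(g has_derivative (\<lambda>w. dir_deriv g w (q + s *\<^sub>R v))) (at (q + s *\<^sub>R v))"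
      by (rule smooth_on_has_derivative[OF that(1) S(1) that(2)])
    have "dir_deriv g (h *\<^sub>R v) (q + s *\<^sub>R v) = h * dir_deriv g v (q + s *\<^sub>R v)" for h
      using linear_scale[OF has_derivative_linear[OF 2]] by simp
    then show ?thesis using has_derivative_compose[OF 1 2] by simp
  qed
  \<comment> \<open>The vectors \<open>a\<close> and \<open>b\<close> are generalized here, with
    membership in \<open>S\<close> as a premise, because the fact is used again with the two
    directions exchanged.\<close>
  have square: "\<exists>s t. 0 < s \<and> s < h \<and> 0 < t \<and> t < h \<and>
      f (p + h *\<^sub>R a + h *\<^sub>R b) - f (p + h *\<^sub>R a) - f (p + h *\<^sub>R b) + f p
        = h * h * dir_deriv (dir_deriv f a) b (p + s *\<^sub>R a + t *\<^sub>R b)"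
    if h: "0 < h" "h < r"
      and inS: "\<And>s t. 0 \<le> s \<Longrightarrow> s < r \<Longrightarrow> 0 \<le> t \<Longrightarrow> t < r \<Longrightarrow> p + s *\<^sub>R a + t *\<^sub>R b \<in> S" for h a b
  proof -
    \<comment> \<open>\<open>?u s\<close> is the increment of \<open>f\<close> along
      \<open>h *\<^sub>R b\<close>, based at \<open>p + s *\<^sub>R a\<close>. The second difference
      is \<open>?u h - ?u 0\<close>; the mean value theorem is applied first in \<open>s\<close>,
      then in \<open>t\<close>.\<close>
    let ?u = "\<lambda>s. f ((p + h *\<^sub>R b) + s *\<^sub>R a) - f (p + s *\<^sub>R a)"
    have "\<exists>s\<in>{0<..<h}. ?u h - ?u 0 =
        (\<lambda>k. k * dir_deriv f a ((p + h *\<^sub>R b) + s *\<^sub>R a) - k * dir_deriv f a (p + s *\<^sub>R a)) (h - 0)"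
    proof (rule mvt_simple[OF h(1)])
      fix s assume s: "0 \<le> s" "s \<le> h"
      have 1: "p + h *\<^sub>R b + s *\<^sub>R a \<in> S" and 2: "p + s *\<^sub>R a \<in> S"
        using inS[of s h] inS[of s 0] s h by (simp_all add: add_ac)
      show "(?u has_derivative
         (\<lambda>k. k * dir_deriv f a ((p + h *\<^sub>R b) + s *\<^sub>R a) - k * dir_deriv f a (p + s *\<^sub>R a))) (at s within {0..h})"
        by (rule has_derivative_at_withinI[OF has_derivative_diff[OF curve[OF f 1] curve[OF f 2]]])
    qed
    then obtain s where s: "0 < s" "s < h" "?u h - ?u 0 =
       h * dir_deriv f a ((p + h *\<^sub>R b) + s *\<^sub>R a) - h * dir_deriv f a (p + s *\<^sub>R a)"
      by auto
    have "\<exists>t\<in>{0<..<h}. dir_deriv f a ((p + s *\<^sub>R a) + h *\<^sub>R b) - dir_deriv f a ((p + s *\<^sub>R a) + 0 *\<^sub>R b)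
       = (\<lambda>k. k * dir_deriv (dir_deriv f a) b ((p + s *\<^sub>R a) + t *\<^sub>R b)) (h - 0)"
    proof (rule mvt_simple[OF h(1)])
      fix t assume t: "0 \<le> t" "t \<le> h"
      have 1: "p + s *\<^sub>R a + t *\<^sub>R b \<in> S" using inS[of s t] s t h by simp
      show "((\<lambda>t. dir_deriv f a ((p + s *\<^sub>R a) + t *\<^sub>R b)) has_derivative
         (\<lambda>k. k * dir_deriv (dir_deriv f a) b ((p + s *\<^sub>R a) + t *\<^sub>R b))) (at t within {0..h})"
        by (rule has_derivative_at_withinI[OF curve[OF smooth_on_dir_deriv[OF f] 1]])
    qed
    then obtain t where t: "0 < t" "t < h"
      "dir_deriv f a ((p + s *\<^sub>R a) + h *\<^sub>R b) - dir_deriv f a ((p + s *\<^sub>R a) + 0 *\<^sub>R b)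
       = h * dir_deriv (dir_deriv f a) b ((p + s *\<^sub>R a) + t *\<^sub>R b)" by auto
    have "f (p + h *\<^sub>R a + h *\<^sub>R b) - f (p + h *\<^sub>R a) - f (p + h *\<^sub>R b) + f p = ?u h - ?u 0"
      by (simp add: add_ac)
    also have "\<dots> = h * (dir_deriv f a ((p + s *\<^sub>R a) + h *\<^sub>R b)
        - dir_deriv f a ((p + s *\<^sub>R a) + 0 *\<^sub>R b))"
      unfolding s(3) by (simp add: right_diff_distrib add_ac)
    also have "\<dots> = h * h * dir_deriv (dir_deriv f a) b ((p + s *\<^sub>R a) + t *\<^sub>R b)"
      unfolding t(3) by simp
    finally show ?thesis using s(1,2) t(1,2) by blast
  qed
  \<comment> \<open>\<open>Suc (Suc n)\<close> makes \<open>h n\<close> strictly smaller than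
    \<open>r\<close> already for \<open>n = 0\<close>.\<close>
  define h where "h n = r * inverse (real (Suc (Suc n)))" for n
  have "inverse (real (Suc (Suc n))) < 1" for n by (rule inverse_less_1_iff[THEN iffD2]) simp
  then have h: "0 < h n" "h n < r" for n
    using r mult_strict_left_mono[of "inverse (real (Suc (Suc n)))" 1 r]
    by (simp_all add: h_def)
  have hlim: "h \<longlonglongrightarrow> 0" unfolding h_def
    by (rule tendsto_mult_right_zero[OF LIMSEQ_Suc[OF LIMSEQ_inverse_real_of_nat]])
  have lim: "(\<lambda>n. G (p + s n *\<^sub>R a + t n *\<^sub>R b)) \<longlonglongrightarrow> G p"
    if "continuous_on S G" "\<And>n. 0 < s n \<and> s n < h n" "\<And>n. 0 < t n \<and> t n < h n"
    for G :: "'a \<Rightarrow> real" and s t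
  proof -
    have "u \<longlonglongrightarrow> 0" if "\<And>n. 0 < u n \<and> u n < h n" for u
      by (rule real_tendsto_sandwich[OF _ _ tendsto_const hlim])
        (use that in \<open>auto intro!: always_eventually less_imp_le\<close>)
    then have "s \<longlonglongrightarrow> 0" "t \<longlonglongrightarrow> 0" using that(2,3) by auto
    then have "(\<lambda>n. p + s n *\<^sub>R a + t n *\<^sub>R b) \<longlonglongrightarrow> p + 0 *\<^sub>R a + 0 *\<^sub>R b"
      by (intro tendsto_intros)
    moreover have "isCont G p" using that(1) S by (simp add: continuous_on_eq_continuous_at)
    ultimately show ?thesis using isCont_tendsto_compose[of p G] by simp
  qed
  have cont: "continuous_on S (dir_deriv (dir_deriv f v) w)" for v w
    using smooth_on_dir_deriv[OF smooth_on_dir_deriv[OF f], of v w]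
    by (auto simp: smooth_on_def dest: spec[of _ 0])
  have "\<forall>n. \<exists>x y. 0 < x \<and> x < h n \<and> 0 < y \<and> y < h n \<and>
      f (p + h n *\<^sub>R a + h n *\<^sub>R b) - f (p + h n *\<^sub>R a) - f (p + h n *\<^sub>R b) + f p
        = h n * h n * dir_deriv (dir_deriv f a) b (p + x *\<^sub>R a + y *\<^sub>R b)"
    using square[OF h inS] by blast
  then obtain s t where st: "\<And>n. 0 < s n \<and> s n < h n" "\<And>n. 0 < t n \<and> t n < h n"
    "\<And>n. f (p + h n *\<^sub>R a + h n *\<^sub>R b) - f (p + h n *\<^sub>R a) - f (p + h n *\<^sub>R b) + f p
        = h n * h n * dir_deriv (dir_deriv f a) b (p + s n *\<^sub>R a + t n *\<^sub>R b)"
    unfolding choice_iff by blast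
  have inS': "p + s *\<^sub>R b + t *\<^sub>R a \<in> S" if "0 \<le> s" "s < r" "0 \<le> t" "t < r" for s t
    using inS[of t s] that by (simp add: algebra_simps)
  have "\<forall>n. \<exists>x y. 0 < x \<and> x < h n \<and> 0 < y \<and> y < h n \<and>
      f (p + h n *\<^sub>R b + h n *\<^sub>R a) - f (p + h n *\<^sub>R b) - f (p + h n *\<^sub>R a) + f p
        = h n * h n * dir_deriv (dir_deriv f b) a (p + x *\<^sub>R b + y *\<^sub>R a)"
    using square[OF h inS'] by blast
  then obtain s' t' where st': "\<And>n. 0 < s' n \<and> s' n < h n" "\<And>n. 0 < t' n \<and> t' n < h n"
    "\<And>n. f (p + h n *\<^sub>R b + h n *\<^sub>R a) - f (p + h n *\<^sub>R b) - f (p + h n *\<^sub>R a) + f p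
        = h n * h n * dir_deriv (dir_deriv f b) a (p + s' n *\<^sub>R b + t' n *\<^sub>R a)"
    unfolding choice_iff by blast
  \<comment> \<open>The second difference is symmetric in \<open>a\<close> and \<open>b\<close>, so
    both evaluations of it agree. The intermediate points differ but both tend to
    \<open>p\<close>.\<close>
  have "h n * h n * dir_deriv (dir_deriv f a) b (p + s n *\<^sub>R a + t n *\<^sub>R b)
     = h n * h n * dir_deriv (dir_deriv f b) a (p + t' n *\<^sub>R a + s' n *\<^sub>R b)" for n
    using st(3)[of n] st'(3)[of n] by (simp add: algebra_simps)
  then have "dir_deriv (dir_deriv f a) b (p + s n *\<^sub>R a + t n *\<^sub>R b)
     = dir_deriv (dir_deriv f b) a (p + t' n *\<^sub>R a + s' n *\<^sub>R b)" for n
    using h(1)[of n] by (metis less_irrefl mult_cancel_left mult_eq_0_iff)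
  then show ?thesis
    using LIMSEQ_unique[OF lim[OF cont[of a b] st(1,2)]] lim[OF cont[of b a] st'(2,1)] by simp
qed

lemma dir_deriv_bounded_linear:
  assumes "bounded_linear h" "f differentiable (at x)"
  shows "dir_deriv (\<lambda>x. h (f x)) v x = h (dir_deriv f v x)"
  using dir_deriv_eq[OF bounded_linear.has_derivative[OF assms(1)]] assms(2)
  by (metis frechet_derivative_works)

text \<open>The mean value theorem needs real values, so the real case is applied to the inner
  products of \<open>f\<close> with fixed vectors.\<close>

lemma dir_deriv_commute:
  fixes f :: "'a::real_normed_vector \<Rightarrow> 'b::real_inner"
  assumes S: "open S" "p \<in> S" and f: "smooth_on f S"
  shows "dir_deriv (dir_deriv f a) b p = dir_deriv (dir_deriv f b) a p"
proof -
  have bl: "bounded_linear (\<lambda>y. y \<bullet> c)" for c :: 'b by (rule bounded_linear_inner_left)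
  have "dir_deriv (dir_deriv (\<lambda>x. f x \<bullet> c) a) b p = dir_deriv (dir_deriv f a) b p \<bullet> c" for a b c
  proof -
    have "dir_deriv (dir_deriv (\<lambda>x. f x \<bullet> c) a) b p = dir_deriv (\<lambda>x. dir_deriv f a x \<bullet> c) b p"
      using S f by (intro dir_deriv_cong[OF S])
        (auto intro!: dir_deriv_bounded_linear[OF bl] smooth_on_differentiable_at)
    also have "\<dots> = dir_deriv (dir_deriv f a) b p \<bullet> c"
      using S f by (intro dir_deriv_bounded_linear[OF bl] smooth_on_differentiable_at smooth_on_dir_deriv)
    finally show ?thesis .
  qed
  then have "dir_deriv (dir_deriv f a) b p \<bullet> c = dir_deriv (dir_deriv f b) a p \<bullet> c" for c
    using dir_deriv_commute_real[OF S smooth_on_bounded_linear[OF S(1) bl f]] by metis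
  then show ?thesis by (metis vector_eq_rdot)
qed

section \<open>Wirtinger derivatives\<close>

text \<open>One operator covers all four coordinate derivatives, so each rule is proved once: weight
  \<open>- \<i>\<close> gives the holomorphic kind and \<open>\<i>\<close> the antiholomorphic
  kind.\<close>

definition wirtinger ::
  "complex \<Rightarrow> 'a \<Rightarrow> 'a \<Rightarrow> ('a::real_normed_vector \<Rightarrow> complex) \<Rightarrow> 'a \<Rightarrow> complex" where
  "wirtinger w a b f p = (dir_deriv f a p + w * dir_deriv f b p) / 2"

lemma d_z_eq: "d_z k = wirtinger (- \<i>) (axis k 1, 0) (axis k \<i>, 0)"
  and d_zbar_eq: "d_zbar k = wirtinger \<i> (axis k 1, 0) (axis k \<i>, 0)"
  and d_eta_eq: "d_eta k = wirtinger (- \<i>) (0, axis k 1) (0, axis k \<i>)"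
  and d_etabar_eq: "d_etabar k = wirtinger \<i> (0, axis k 1) (0, axis k \<i>)"
  by (simp_all add: fun_eq_iff wirtinger_def d_z_def d_zbar_def d_eta_def d_etabar_def)

lemmas wirtinger_eqs = d_z_eq d_zbar_eq d_eta_eq d_etabar_eq

lemma wirtinger_eqI:
  "(f has_derivative D) (at p) \<Longrightarrow> wirtinger w a b f p = (D a + w * D b) / 2"
  by (simp add: wirtinger_def dir_deriv_eq)

lemma wirtinger_const [simp]: "wirtinger w a b (\<lambda>x. c) p = 0"
  by (simp add: wirtinger_def)

lemma wirtinger_cong:
  "open S \<Longrightarrow> p \<in> S \<Longrightarrow> (\<And>q. q \<in> S \<Longrightarrow> f q = g q) \<Longrightarrow> wirtinger w a b f p = wirtinger w a b g p"
  unfolding wirtinger_def using dir_deriv_cong[of S p f g] by simp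

lemma wirtinger_diff:
  assumes "open S" "p \<in> S" "smooth_on f S" "smooth_on g S"
  shows "wirtinger w a b (\<lambda>x. f x - g x) p = wirtinger w a b f p - wirtinger w a b g p"
  unfolding wirtinger_eqI[OF has_derivative_diff[OF
        smooth_on_has_derivative[OF assms(3,1,2)] smooth_on_has_derivative[OF assms(4,1,2)]]]
  by (simp add: wirtinger_def field_simps)

lemma wirtinger_mult:
  assumes "open S" "p \<in> S" "smooth_on f S" "smooth_on g S"
  shows "wirtinger w a b (\<lambda>x. f x * g x) p = wirtinger w a b f p * g p + f p * wirtinger w a b g p"
  unfolding wirtinger_eqI[OF has_derivative_mult[OF
        smooth_on_has_derivative[OF assms(3,1,2)] smooth_on_has_derivative[OF assms(4,1,2)]]]
  by (simp add: wirtinger_def field_simps)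

lemma wirtinger_sum:
  assumes "open S" "p \<in> S" "\<And>i. i \<in> I \<Longrightarrow> smooth_on (f i) S"
  shows "wirtinger w a b (\<lambda>x. \<Sum>i\<in>I. f i x) p = (\<Sum>i\<in>I. wirtinger w a b (f i) p)"
  by (subst wirtinger_eqI[OF has_derivative_sum[OF smooth_on_has_derivative[OF assms(3,1,2)]]])
    (simp_all add: wirtinger_def sum.distrib sum_distrib_left flip: sum_divide_distrib)

text \<open>Replacing \<open>w\<close> by \<open>cnj w\<close> is what exchanges holomorphic and
  antiholomorphic derivatives under conjugation.\<close>

lemma wirtinger_cnj:
  assumes "open S" "p \<in> S" "smooth_on f S"
  shows "wirtinger w a b (\<lambda>x. cnj (f x)) p = cnj (wirtinger (cnj w) a b f p)"
  unfolding wirtinger_eqI[OF bounded_linear.has_derivative[OF bounded_linear_cnj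
        smooth_on_has_derivative[OF assms(3,1,2)]]]
  by (simp add: wirtinger_def)

lemma wirtinger_bounded_linear:
  "bounded_linear h \<Longrightarrow> wirtinger w a b h p = (h a + w * h b) / 2"
  by (rule wirtinger_eqI[OF bounded_linear_imp_has_derivative])

lemma smooth_on_wirtinger:
  assumes "open S" "smooth_on f S"
  shows "smooth_on (wirtinger w a b f) S"
proof -
  have "smooth_on (\<lambda>p. (dir_deriv f a p + w * dir_deriv f b p) * (1 / 2)) S"
    by (intro smooth_on_mult smooth_on_add smooth_on_const smooth_on_dir_deriv assms)
  then show ?thesis by (simp add: wirtinger_def[abs_def])
qed

lemma dir_deriv_wirtinger:
  assumes "open S" "p \<in> S" "smooth_on f S"
  shows "dir_deriv (wirtinger w a b f) v p
    = (dir_deriv (dir_deriv f a) v p + w * dir_deriv (dir_deriv f b) v p) / 2"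
proof -
  note D = smooth_on_has_derivative[OF smooth_on_dir_deriv[OF assms(3)] assms(1,2)]
  have "((\<lambda>p. (dir_deriv f a p + w * dir_deriv f b p) / 2) has_derivative
      (\<lambda>v. (dir_deriv (dir_deriv f a) v p + w * dir_deriv (dir_deriv f b) v p) / 2)) (at p)"
    by (rule bounded_linear.has_derivative[OF bounded_linear_divide
          has_derivative_add[OF D bounded_linear.has_derivative[OF bounded_linear_mult_right D]]])
  then show ?thesis by (simp add: wirtinger_def[abs_def] dir_deriv_eq)
qed

text \<open>Both sides expand into the same four real second derivatives, up to the order of the
  directions.\<close>

lemma wirtinger_commute:
  assumes "open S" "p \<in> S" "smooth_on f S"
  shows "wirtinger w a b (wirtinger w' c d f) p = wirtinger w' c d (wirtinger w a b f) p"
  unfolding wirtinger_def[of w a b "wirtinger w' c d f"] wirtinger_def[of w' c d "wirtinger w a b f"]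
    dir_deriv_wirtinger[OF assms]
  by (simp add: dir_deriv_commute[OF assms, of c] dir_deriv_commute[OF assms, of d] field_simps)

lemma bounded_linear_snd_nth: "bounded_linear (\<lambda>p. snd p $ l)"
  by (rule bounded_linear_compose[OF bounded_linear_vec_nth bounded_linear_snd])

lemma smooth_on_snd_nth: "open S \<Longrightarrow> smooth_on (\<lambda>p. snd p $ l) S"
  by (rule smooth_on_bounded_linear[OF _ bounded_linear_snd_nth smooth_on_ident])

lemma d_eta_coord: "d_eta k (\<lambda>p. snd p $ l) p = (if k = l then 1 else 0)"
  and d_z_coord: "d_z k (\<lambda>p. snd p $ l) p = 0"
  and d_zbar_coord: "d_zbar k (\<lambda>p. snd p $ l) p = 0"
  and d_etabar_coord: "d_etabar k (\<lambda>p. snd p $ l) p = 0"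
  by (auto simp: wirtinger_eqs wirtinger_bounded_linear[OF bounded_linear_snd_nth] axis_def)

section \<open>Determinants and inverses of smooth matrices\<close>

lemma smooth_on_det:
  fixes A :: "'a::real_normed_vector \<Rightarrow> complex^'n^'n"
  assumes "open S" "\<And>i j. smooth_on (\<lambda>p. A p $ i $ j) S"
  shows "smooth_on (\<lambda>p. det (A p)) S"
  unfolding det_def
  by (intro smooth_on_sum smooth_on_mult smooth_on_prod smooth_on_const assms)

lemma matrix_inv:
  fixes A :: "'a::semiring_1^'n^'m"
  assumes "invertible A"
  shows "A ** matrix_inv A = mat 1" "matrix_inv A ** A = mat 1"
  using someI_ex[OF assms[unfolded invertible_def]] by (simp_all add: matrix_inv_def)

text \<open>Cramer's rule writes each entry of the inverse as a quotient of two determinants, and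
  these are polynomials in the entries.\<close>

lemma smooth_on_matrix_inv:
  fixes A :: "'a::real_normed_vector \<Rightarrow> complex^'n^'n"
  assumes S: "open S" and A: "\<And>i j. smooth_on (\<lambda>p. A p $ i $ j) S"
    and inv: "\<And>p. p \<in> S \<Longrightarrow> invertible (A p)"
  shows "smooth_on (\<lambda>p. matrix_inv (A p) $ m $ i) S"
proof -
  \<comment> \<open>Column \<open>m\<close> is replaced by the unit vector \<open>axis i 1\<close>:
    column \<open>i\<close> of the inverse solves the linear system with that right-hand
    side.\<close>
  let ?B = "\<lambda>p. \<chi> a b. if b = m then axis i 1 $ a else A p $ a $ b"
  have "matrix_inv (A p) $ m $ i = det (?B p) / det (A p)" if "p \<in> S" for p
  proof -
    have "A p *v (matrix_inv (A p) *v axis i 1) = axis i 1"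
      by (simp add: matrix_vector_mul_assoc matrix_inv(1) inv that)
    then have "(matrix_inv (A p) *v axis i 1) $ m = det (?B p) / det (A p)"
      using cramer[of "A p"] inv[OF that] by (simp add: invertible_det_nz)
    then show ?thesis
      by (simp add: matrix_vector_mult_def axis_def if_distrib cong: if_cong)
  qed
  moreover have "smooth_on (\<lambda>p. det (?B p) / det (A p)) S"
  proof (intro smooth_on_divide smooth_on_det S A)
    show "det (A p) \<noteq> 0" if "p \<in> S" for p using inv[OF that] by (simp add: invertible_det_nz)
    show "smooth_on (\<lambda>p. ?B p $ a $ b) S" for a b
      using A by (cases "b = m") (simp_all add: smooth_on_const)
  qed
  ultimately show ?thesis by (metis (no_types, lifting) smooth_on_cong S)
qed

section \<open>The Chern--Finsler connection in a chart\<close>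

locale finsler_chart =
  fixes f :: "(complex^'n::finite) \<times> (complex^'n) \<Rightarrow> real" and S
  assumes open_S: "open S"
    and smooth_f2: "smooth_on (\<lambda>p. (f p)\<^sup>2) S"
    and homogeneous: "(z, \<eta>) \<in> S \<Longrightarrow> l \<noteq> 0 \<Longrightarrow> f (z, l *s \<eta>) = cmod l * f (z, \<eta>)"
    and metric_nondeg: "p \<in> S \<Longrightarrow> \<zeta> \<noteq> 0 \<Longrightarrow>
      (\<Sum>i\<in>UNIV. \<Sum>j\<in>UNIV. metric f i j p * \<zeta> $ i * cnj (\<zeta> $ j)) \<noteq> 0"
begin

text \<open>This is L = F^2, made complex valued so that Wirtinger derivatives apply to it.\<close>

definition energy where "energy p = complex_of_real ((f p)\<^sup>2)"

lemma metric_eq: "metric f i j = d_eta i (d_etabar j energy)"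
  by (simp add: metric_def energy_def[abs_def])

lemma smooth_energy: "smooth_on energy S"
  using smooth_on_bounded_linear[OF open_S bounded_linear_of_real smooth_f2]
  by (simp add: energy_def[abs_def])

lemma smooth_wirtinger [intro]:
  assumes "smooth_on h S"
  shows "smooth_on (d_z k h) S" "smooth_on (d_zbar k h) S" "smooth_on (d_eta k h) S"
    "smooth_on (d_etabar k h) S"
  by (simp_all add: wirtinger_eqs smooth_on_wirtinger[OF open_S assms])

section \<open>Smoothness and nondegeneracy of the metric\<close>

lemma smooth_metric: "smooth_on (metric f i j) S"
  unfolding metric_eq by (intro smooth_wirtinger smooth_energy)

text \<open>Contracting the assumption with the conjugate of \<open>X\<close> makes the Hermitian
  form vanish at \<open>X\<close>, which \<open>metric_nondeg\<close> forbids for a nonzero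
  vector.\<close>

lemma metric_ker:
  assumes "p \<in> S" "\<And>r. (\<Sum>i\<in>UNIV. X i * metric f i r p) = 0"
  shows "X i = 0"
proof (rule ccontr)
  assume "X i \<noteq> 0"
  then have "(\<chi> i. X i) \<noteq> 0" by (auto simp: vec_eq_iff)
  from metric_nondeg[OF assms(1) this]
  have "(\<Sum>i\<in>UNIV. \<Sum>j\<in>UNIV. metric f i j p * X i * cnj (X j)) \<noteq> 0" by simp
  moreover have "(\<Sum>i\<in>UNIV. \<Sum>j\<in>UNIV. metric f i j p * X i * cnj (X j))
      = (\<Sum>j\<in>UNIV. cnj (X j) * (\<Sum>i\<in>UNIV. X i * metric f i j p))"
    by (subst sum.swap) (simp add: sum_distrib_left mult_ac)
  ultimately show False using assms(2) by simp
qed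

text \<open>Identities may be checked after lowering the upper index, where the inverse metric
  disappears.\<close>

lemma metric_cancel:
  assumes "p \<in> S"
    "\<And>r. (\<Sum>i\<in>UNIV. X i * metric f i r p) = (\<Sum>i\<in>UNIV. Y i * metric f i r p)"
  shows "X i = Y i"
  using metric_ker[OF assms(1), of "\<lambda>i. X i - Y i" i] assms(2)
  by (simp add: left_diff_distrib sum_subtractf)

lemma invertible_metric:
  assumes "p \<in> S"
  shows "invertible (metric_mat f p)"
proof -
  \<comment> \<open>\<open>metric_ker\<close> sums over the first index of the metric, so it
    describes the kernel of the transposed matrix.\<close>
  have "\<forall>x. transpose (metric_mat f p) *v x = 0 \<longrightarrow> x = 0"
  proof (intro allI impI)
    fix x assume "transpose (metric_mat f p) *v x = 0"
    then have "(\<Sum>i\<in>UNIV. x $ i * metric f i r p) = 0" for r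
      by (simp add: vec_eq_iff matrix_vector_mult_def transpose_def metric_mat_def mult.commute)
    then show "x = 0" using metric_ker[OF assms] by (simp add: vec_eq_iff)
  qed
  then have "invertible (transpose (metric_mat f p))"
    by (simp add: invertible_left_inverse matrix_left_invertible_ker)
  then show ?thesis by (simp add: invertible_det_nz)
qed

lemma smooth_metric_inv: "smooth_on (metric_inv f m i) S"
  using smooth_on_matrix_inv[OF open_S _ invertible_metric, where m = m and i = i] smooth_metric
  by (simp add: metric_inv_def[abs_def] metric_mat_def)

lemma smooth_nonlin_conn: "smooth_on (nonlin_conn f k j) S"
  unfolding nonlin_conn_def[abs_def]
  by (intro smooth_on_sum smooth_on_mult smooth_on_snd_nth smooth_wirtinger smooth_metric
      smooth_metric_inv open_S)

lemma smooth_conn_L: "smooth_on (conn_L f i j k) S"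
  unfolding conn_L_def[abs_def] delta_def
  by (intro smooth_on_sum smooth_on_mult smooth_on_diff smooth_wirtinger smooth_metric
      smooth_metric_inv smooth_nonlin_conn open_S)

lemma lower_raise:
  assumes "p \<in> S"
  shows "(\<Sum>i\<in>UNIV. (\<Sum>m\<in>UNIV. metric_inv f m i p * X m) * metric f i r p) = X r"
proof -
  have "(\<Sum>i\<in>UNIV. metric_inv f m i p * metric f i r p) = (if m = r then 1 else 0)" for m
    using matrix_inv(2)[OF invertible_metric[OF assms]]
    by (simp add: vec_eq_iff matrix_matrix_mult_def mat_def metric_inv_def metric_mat_def)
  then have "(\<Sum>m\<in>UNIV. (\<Sum>i\<in>UNIV. metric_inv f m i p * metric f i r p) * X m) = X r"
    by (simp add: if_distrib[of "\<lambda>x. x * _"] cong: if_cong)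
  moreover have "(\<Sum>i\<in>UNIV. (\<Sum>m\<in>UNIV. metric_inv f m i p * X m) * metric f i r p)
      = (\<Sum>m\<in>UNIV. (\<Sum>i\<in>UNIV. metric_inv f m i p * metric f i r p) * X m)"
    unfolding sum_distrib_right by (subst sum.swap) (simp add: mult_ac)
  ultimately show ?thesis by simp
qed

section \<open>Euler identities from homogeneity\<close>

lemma euler:
  assumes "p \<in> S"
  shows "(\<Sum>l\<in>UNIV. snd p $ l * d_eta l energy p) = energy p"
proof -
  obtain z \<eta> where p: "p = (z, \<eta>)" by (cases p)
  let ?D = "\<lambda>v. dir_deriv energy v p"
  note D = smooth_on_has_derivative[OF smooth_energy open_S assms]
  interpret D: linear ?D using has_derivative_linear[OF D] .
  \<comment> \<open>Homogeneity multiplies the energy by the squared modulus of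
    \<open>1 + t * c\<close> along this curve; differentiating at \<open>t = 0\<close> gives the
    factor \<open>2 * Re c\<close>.\<close>
  have radial: "?D (0, c *s \<eta>) = 2 * of_real (Re c) * energy p" for c
  proof -
    have "((\<lambda>t::real. (z, \<eta> + t *\<^sub>R (c *s \<eta>))) has_derivative (\<lambda>t. (0, t *\<^sub>R (c *s \<eta>)))) (at 0)"
      by (auto intro!: derivative_eq_intros)
    from has_derivative_compose[OF this, of energy ?D] D
    have 1: "((\<lambda>t::real. energy (z, \<eta> + t *\<^sub>R (c *s \<eta>))) has_derivative (\<lambda>t. ?D (0, t *\<^sub>R (c *s \<eta>)))) (at 0)"
      by (simp add: p)
    have "((\<lambda>t::real. of_real ((1 + t * Re c)\<^sup>2 + (t * Im c)\<^sup>2) * energy p) has_derivative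
        (\<lambda>t. of_real (2 * t * Re c) * energy p)) (at 0)"
      by (auto intro!: derivative_eq_intros)
    \<comment> \<open>\<open>homogeneous\<close> requires a nonzero factor. This holds on an open
      set of \<open>t\<close> containing 0, which is enough for the derivative there.\<close>
    moreover have "open {t::real. 1 + of_real t * c \<noteq> 0}"
      by (intro open_Collect_neq continuous_intros)
    moreover have "of_real ((1 + t * Re c)\<^sup>2 + (t * Im c)\<^sup>2) * energy p = energy (z, \<eta> + t *\<^sub>R (c *s \<eta>))"
      if "t \<in> {t::real. 1 + of_real t * c \<noteq> 0}" for t
    proof -
      have "\<eta> + t *\<^sub>R (c *s \<eta>) = (1 + of_real t * c) *s \<eta>"
        by (simp add: vec_eq_iff scaleR_conv_of_real[where 'a = complex] algebra_simps)
      then have "energy (z, \<eta> + t *\<^sub>R (c *s \<eta>)) = of_real ((cmod (1 + of_real t * c))\<^sup>2) * energy p"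
        using homogeneous[of z \<eta> "1 + of_real t * c"] that assms
        by (simp add: p energy_def power_mult_distrib)
      also have "(cmod (1 + of_real t * c))\<^sup>2 = (1 + t * Re c)\<^sup>2 + (t * Im c)\<^sup>2"
        by (simp add: cmod_power2)
      finally show ?thesis by simp
    qed
    ultimately have "((\<lambda>t::real. energy (z, \<eta> + t *\<^sub>R (c *s \<eta>))) has_derivative
        (\<lambda>t. of_real (2 * t * Re c) * energy p)) (at 0)"
      by (elim has_derivative_transform_within_open) auto
    from fun_cong[OF has_derivative_unique[OF 1 this], of 1] show ?thesis by simp
  qed
  have "?D (0, c *s \<eta>) = (\<Sum>l\<in>UNIV. ?D (0, axis l (c * \<eta> $ l)))" for c
  proof -
    have "(0, c *s \<eta>) = (\<Sum>l\<in>UNIV. (0 :: complex^'n, axis l (c * \<eta> $ l)))"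
      by (simp add: sum_prod vec_eq_iff axis_def)
    then show ?thesis by (simp add: D.sum)
  qed
  \<comment> \<open>The directions \<open>\<eta>\<close> and \<open>\<i> *s \<eta>\<close> give the
    values \<open>2 * energy p\<close> and 0; the Wirtinger sum is half the first minus
    \<open>\<i>\<close> times the second.\<close>
  from this[of 1] this[of \<i>] radial[of 1] radial[of \<i>]
  have "(\<Sum>l\<in>UNIV. ?D (0, axis l (\<eta> $ l))) = 2 * energy p" "(\<Sum>l\<in>UNIV. ?D (0, axis l (\<i> * \<eta> $ l))) = 0"
    by simp_all
  moreover have "2 * (\<eta> $ l * d_eta l energy p) = ?D (0, axis l (\<eta> $ l)) - \<i> * ?D (0, axis l (\<i> * \<eta> $ l))" for l
  proof -
    \<comment> \<open>The derivative is only real linear, so a complex coordinate is split into its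
      real and imaginary parts.\<close>
    have "(0, axis l a) = Re a *\<^sub>R (0 :: complex^'n, axis l 1) + Im a *\<^sub>R (0, axis l \<i>)" for a
      by (simp add: vec_eq_iff axis_def complex_eq_iff)
    then have "?D (0, axis l a) = Re a *\<^sub>R ?D (0, axis l 1) + Im a *\<^sub>R ?D (0, axis l \<i>)" for a
      by (metis D.add D.scale)
    from this[of "\<eta> $ l"] this[of "\<i> * \<eta> $ l"]
    have "\<eta> $ l * (?D (0, axis l 1) - \<i> * ?D (0, axis l \<i>))
        = ?D (0, axis l (\<eta> $ l)) - \<i> * ?D (0, axis l (\<i> * \<eta> $ l))"
      by (simp add: complex_eq_iff algebra_simps)
    then show ?thesis by (simp add: d_eta_def)
  qed
  ultimately have "2 * (\<Sum>l\<in>UNIV. \<eta> $ l * d_eta l energy p) = 2 * energy p"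
    unfolding sum_distrib_left[of 2] by (simp add: sum_subtractf flip: sum_distrib_left)
  then show ?thesis by (simp add: p)
qed

text \<open>Apply \<open>d_etabar r\<close> to \<open>euler\<close>: it annihilates the coordinates,
  and commuting it past \<open>d_eta l\<close> produces the metric.\<close>

lemma euler_etabar:
  assumes "p \<in> S"
  shows "(\<Sum>l\<in>UNIV. snd p $ l * metric f l r p) = d_etabar r energy p"
proof -
  have "d_etabar r energy p = d_etabar r (\<lambda>q. \<Sum>l\<in>UNIV. snd q $ l * d_eta l energy q) p"
    using wirtinger_cong[OF open_S assms euler[symmetric]] by (simp add: d_etabar_eq)
  also have "\<dots> = (\<Sum>l\<in>UNIV. d_etabar r (\<lambda>q. snd q $ l * d_eta l energy q) p)"
    unfolding d_etabar_eq
    by (intro wirtinger_sum[OF open_S assms] smooth_on_mult smooth_on_snd_nth smooth_wirtinger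
        smooth_energy open_S)
  also have "\<dots> = (\<Sum>l\<in>UNIV. snd p $ l * d_etabar r (d_eta l energy) p)"
    unfolding d_etabar_eq wirtinger_mult[OF open_S assms smooth_on_snd_nth[OF open_S]
        smooth_wirtinger(3)[OF smooth_energy]] d_etabar_coord[unfolded d_etabar_eq]
    by simp
  also have "\<dots> = (\<Sum>l\<in>UNIV. snd p $ l * metric f l r p)"
    unfolding metric_eq wirtinger_eqs by (simp add: wirtinger_commute[OF open_S assms smooth_energy])
  finally show ?thesis by simp
qed

lemma d_z_euler_etabar:
  assumes "p \<in> S"
  shows "(\<Sum>l\<in>UNIV. snd p $ l * d_z k (metric f l r) p) = d_z k (d_etabar r energy) p"
proof -
  have "d_z k (d_etabar r energy) p = d_z k (\<lambda>q. \<Sum>l\<in>UNIV. snd q $ l * metric f l r q) p"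
    using wirtinger_cong[OF open_S assms euler_etabar[symmetric]] by (simp add: d_z_eq)
  also have "\<dots> = (\<Sum>l\<in>UNIV. d_z k (\<lambda>q. snd q $ l * metric f l r q) p)"
    unfolding d_z_eq
    by (intro wirtinger_sum[OF open_S assms] smooth_on_mult smooth_on_snd_nth smooth_metric open_S)
  also have "\<dots> = (\<Sum>l\<in>UNIV. snd p $ l * d_z k (metric f l r) p)"
    unfolding d_z_eq wirtinger_mult[OF open_S assms smooth_on_snd_nth[OF open_S] smooth_metric]
      d_z_coord[unfolded d_z_eq]
    by simp
  finally show ?thesis by simp
qed

text \<open>Apply \<open>d_eta k\<close> to \<open>euler_etabar\<close>. Differentiating the
  coordinate reproduces \<open>metric f k r\<close>, which is also the left-hand side, so the
  remaining sum is zero.\<close>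

lemma d_eta_euler_etabar:
  assumes "p \<in> S"
  shows "(\<Sum>l\<in>UNIV. snd p $ l * d_eta k (metric f l r) p) = 0"
proof -
  have "metric f k r p = d_eta k (\<lambda>q. \<Sum>l\<in>UNIV. snd q $ l * metric f l r q) p"
    using wirtinger_cong[OF open_S assms euler_etabar[symmetric]] by (simp add: d_eta_eq metric_eq)
  also have "\<dots> = (\<Sum>l\<in>UNIV. d_eta k (\<lambda>q. snd q $ l * metric f l r q) p)"
    unfolding d_eta_eq
    by (intro wirtinger_sum[OF open_S assms] smooth_on_mult smooth_on_snd_nth smooth_metric open_S)
  also have "\<dots> = (\<Sum>l\<in>UNIV. (if k = l then 1 else 0) * metric f l r p + snd p $ l * d_eta k (metric f l r) p)"
    unfolding d_eta_eq wirtinger_mult[OF open_S assms smooth_on_snd_nth[OF open_S] smooth_metric]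
      d_eta_coord[unfolded d_eta_eq] ..
  also have "\<dots> = metric f k r p + (\<Sum>l\<in>UNIV. snd p $ l * d_eta k (metric f l r) p)"
    by (simp add: sum.distrib if_distrib[of "\<lambda>x. x * _"] cong: if_cong)
  finally show ?thesis by simp
qed

section \<open>The connections with lowered upper index\<close>

lemma d_eta_metric_commute:
  assumes "p \<in> S"
  shows "d_eta k (metric f l r) p = d_eta l (metric f k r) p"
  unfolding metric_eq d_eta_eq
  by (rule wirtinger_commute[OF open_S assms smooth_wirtinger(4)[OF smooth_energy]])

lemma nonlin_conn_lower:
  assumes "p \<in> S"
  shows "(\<Sum>i\<in>UNIV. nonlin_conn f i k p * metric f i r p) = d_z k (d_etabar r energy) p"
proof -
  have "nonlin_conn f i k p
      = (\<Sum>m\<in>UNIV. metric_inv f m i p * (\<Sum>l\<in>UNIV. snd p $ l * d_z k (metric f l m) p))" for i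
    by (simp add: nonlin_conn_def sum_distrib_left mult_ac)
  then show ?thesis by (simp add: lower_raise[OF assms] d_z_euler_etabar[OF assms])
qed

lemma conn_L_lower:
  assumes "p \<in> S"
  shows "(\<Sum>i\<in>UNIV. conn_L f i j k p * metric f i r p) = delta f k (metric f j r) p"
  by (simp add: conn_L_def lower_raise[OF assms])

text \<open>After lowering, the \<open>d_z\<close> part of \<open>delta\<close> gives the lowered
  \<open>nonlin_conn\<close>, and its \<open>d_eta\<close> part vanishes by
  \<open>d_eta_euler_etabar\<close>.\<close>

lemma conn_L_contract:
  assumes "p \<in> S"
  shows "(\<Sum>j\<in>UNIV. snd p $ j * conn_L f i j k p) = nonlin_conn f i k p"
proof (rule metric_cancel[OF assms, where X = "\<lambda>i. \<Sum>j\<in>UNIV. snd p $ j * conn_L f i j k p"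
      and Y = "\<lambda>i. nonlin_conn f i k p"])
  fix r
  have "(\<Sum>i\<in>UNIV. (\<Sum>j\<in>UNIV. snd p $ j * conn_L f i j k p) * metric f i r p)
      = (\<Sum>j\<in>UNIV. snd p $ j * (\<Sum>i\<in>UNIV. conn_L f i j k p * metric f i r p))"
    unfolding sum_distrib_right sum_distrib_left by (subst sum.swap) (simp add: mult_ac)
  also have "\<dots> = (\<Sum>j\<in>UNIV. snd p $ j * d_z k (metric f j r) p)
      - (\<Sum>j\<in>UNIV. \<Sum>m\<in>UNIV. nonlin_conn f m k p * (snd p $ j * d_eta m (metric f j r) p))"
    unfolding conn_L_lower[OF assms] delta_def
    by (simp add: right_diff_distrib sum_subtractf sum_distrib_left mult_ac)
  also have "(\<Sum>j\<in>UNIV. \<Sum>m\<in>UNIV. nonlin_conn f m k p * (snd p $ j * d_eta m (metric f j r) p)) = 0"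
    by (subst sum.swap) (simp add: d_eta_euler_etabar[OF assms] flip: sum_distrib_left)
  finally show "(\<Sum>i\<in>UNIV. (\<Sum>j\<in>UNIV. snd p $ j * conn_L f i j k p) * metric f i r p)
      = (\<Sum>i\<in>UNIV. nonlin_conn f i k p * metric f i r p)"
    by (simp add: d_z_euler_etabar[OF assms] nonlin_conn_lower[OF assms])
qed

lemma conn_C_contract:
  assumes "p \<in> S"
  shows "(\<Sum>j\<in>UNIV. snd p $ j * conn_C f i j l p) = 0"
proof -
  have "(\<Sum>j\<in>UNIV. snd p $ j * conn_C f i j l p)
      = (\<Sum>m\<in>UNIV. metric_inv f m i p * (\<Sum>j\<in>UNIV. snd p $ j * d_eta l (metric f j m) p))"
    unfolding conn_C_def sum_distrib_left by (subst sum.swap) (simp add: mult_ac)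
  then show ?thesis by (simp add: d_eta_euler_etabar[OF assms])
qed

text \<open>Differentiating the lowered identity avoids derivatives of the inverse metric. The
  operator stays general because both \<open>d_eta\<close> and \<open>d_etabar\<close> are
  needed.\<close>

lemma wirtinger_nonlin_conn_lower:
  assumes "p \<in> S"
  shows "(\<Sum>i\<in>UNIV. wirtinger w a b (nonlin_conn f i k) p * metric f i r p)
    = wirtinger w a b (d_z k (d_etabar r energy)) p
      - (\<Sum>i\<in>UNIV. nonlin_conn f i k p * wirtinger w a b (metric f i r) p)"
proof -
  have "wirtinger w a b (d_z k (d_etabar r energy)) p
      = wirtinger w a b (\<lambda>q. \<Sum>i\<in>UNIV. nonlin_conn f i k q * metric f i r q) p"
    by (rule wirtinger_cong[OF open_S assms]) (simp add: nonlin_conn_lower)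
  also have "\<dots> = (\<Sum>i\<in>UNIV. wirtinger w a b (\<lambda>q. nonlin_conn f i k q * metric f i r q) p)"
    by (intro wirtinger_sum[OF open_S assms] smooth_on_mult smooth_nonlin_conn smooth_metric open_S)
  finally show ?thesis
    unfolding wirtinger_mult[OF open_S assms smooth_nonlin_conn smooth_metric] sum.distrib
    by simp
qed

text \<open>With the upper index lowered, the two sides differ only by the exchange of two
  holomorphic fibre derivatives of the energy.\<close>

lemma conn_L_eq_d_eta_nonlin_conn:
  assumes "p \<in> S"
  shows "conn_L f i j k p = d_eta j (nonlin_conn f i k) p"
proof (rule metric_cancel[OF assms, where X = "\<lambda>i. conn_L f i j k p"
      and Y = "\<lambda>i. d_eta j (nonlin_conn f i k) p"])
  fix r
  have "d_eta j (d_z k (d_etabar r energy)) p = d_z k (metric f j r) p"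
    unfolding metric_eq wirtinger_eqs
    by (rule wirtinger_commute[OF open_S assms smooth_on_wirtinger[OF open_S smooth_energy]])
  then show "(\<Sum>i\<in>UNIV. conn_L f i j k p * metric f i r p)
      = (\<Sum>i\<in>UNIV. d_eta j (nonlin_conn f i k) p * metric f i r p)"
    using wirtinger_nonlin_conn_lower[OF assms, of "- \<i>" "(0, axis j 1)" "(0, axis j \<i>)" k r]
    by (simp add: conn_L_lower[OF assms] delta_def d_eta_metric_commute[OF assms, of j] flip: d_eta_eq)
qed

text \<open>\<open>wirtinger_nonlin_conn_lower\<close> leaves third derivatives of the energy in
  which \<open>l\<close> and \<open>r\<close> both label antiholomorphic fibre derivatives, so they
  may be exchanged.\<close>

lemma d_etabar_nonlin_conn_lower_commute:
  assumes "p \<in> S"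
  shows "(\<Sum>i\<in>UNIV. d_etabar l (nonlin_conn f i k) p * metric f i r p)
    = (\<Sum>i\<in>UNIV. d_etabar r (nonlin_conn f i k) p * metric f i l p)"
proof -
  note W = smooth_on_wirtinger[OF open_S] and C = wirtinger_commute[OF open_S assms]
  \<comment> \<open>Unlike \<open>C\<close>, this holds at every point of \<open>S\<close>, as
    required for a swap underneath an outer derivative.\<close>
  have C': "wirtinger w a b (wirtinger w' c d h) q = wirtinger w' c d (wirtinger w a b h) q"
    if "q \<in> S" "smooth_on h S" for w a b w' c d h q
    using wirtinger_commute[OF open_S that] .
  \<comment> \<open>The outermost and innermost derivatives are exchanged by three adjacent
    swaps.\<close>
  have D: "wirtinger w a b (wirtinger w' c d (wirtinger w'' e e' energy)) p
      = wirtinger w'' e e' (wirtinger w' c d (wirtinger w a b energy)) p" for w a b w' c d w'' e e'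
  proof -
    have "wirtinger w a b (wirtinger w' c d (wirtinger w'' e e' energy)) p
        = wirtinger w' c d (wirtinger w a b (wirtinger w'' e e' energy)) p"
      by (rule C[OF W[OF smooth_energy]])
    also have "\<dots> = wirtinger w' c d (wirtinger w'' e e' (wirtinger w a b energy)) p"
      by (rule wirtinger_cong[OF open_S assms]) (rule C'[OF _ smooth_energy])
    also have "\<dots> = wirtinger w'' e e' (wirtinger w' c d (wirtinger w a b energy)) p"
      by (rule C[OF W[OF smooth_energy]])
    finally show ?thesis .
  qed
  have "d_etabar l (metric f i r) p = d_etabar r (metric f i l) p" for i
    unfolding metric_eq wirtinger_eqs by (rule D)
  moreover have "d_etabar l (d_z k (d_etabar r energy)) p = d_etabar r (d_z k (d_etabar l energy)) p"
    unfolding wirtinger_eqs by (rule D)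
  ultimately show ?thesis
    using wirtinger_nonlin_conn_lower[OF assms, of \<i> "(0, axis l 1)" "(0, axis l \<i>)" k r]
      wirtinger_nonlin_conn_lower[OF assms, of \<i> "(0, axis r 1)" "(0, axis r \<i>)" k l]
    by (simp flip: d_etabar_eq)
qed

text \<open>Both parts of \<open>delta_bar\<close> are antiholomorphic derivatives and annihilate
  the fibre coordinates, which therefore act as constants.\<close>

lemma delta_bar_sum_coord:
  assumes "p \<in> S" "\<And>j. smooth_on (X j) S"
  shows "delta_bar f h (\<lambda>q. \<Sum>j\<in>UNIV. snd q $ j * X j q) p
    = (\<Sum>j\<in>UNIV. snd p $ j * delta_bar f h (X j) p)"
proof -
  have "wirtinger w a b (\<lambda>q. \<Sum>j\<in>UNIV. snd q $ j * X j q) p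
      = (\<Sum>j\<in>UNIV. wirtinger w a b (\<lambda>q. snd q $ j * X j q) p)" for w a b
    by (intro wirtinger_sum[OF open_S assms(1)] smooth_on_mult smooth_on_snd_nth assms open_S)
  then have "d_zbar h (\<lambda>q. \<Sum>j\<in>UNIV. snd q $ j * X j q) p = (\<Sum>j\<in>UNIV. snd p $ j * d_zbar h (X j) p)"
    and "d_etabar l (\<lambda>q. \<Sum>j\<in>UNIV. snd q $ j * X j q) p = (\<Sum>j\<in>UNIV. snd p $ j * d_etabar l (X j) p)" for l
    using d_zbar_coord[of h _ p] d_etabar_coord[of l _ p]
    unfolding d_zbar_eq d_etabar_eq
    by (simp_all add: wirtinger_mult[OF open_S assms(1) smooth_on_snd_nth[OF open_S] assms(2)])
  moreover have "(\<Sum>l\<in>UNIV. c l * (\<Sum>j\<in>UNIV. snd p $ j * Y l j))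
      = (\<Sum>j\<in>UNIV. snd p $ j * (\<Sum>l\<in>UNIV. c l * Y l j))" for c :: "'n \<Rightarrow> complex" and Y
    unfolding sum_distrib_left by (subst sum.swap) (simp add: mult_ac)
  ultimately show ?thesis
    unfolding delta_bar_def by (simp add: right_diff_distrib sum_subtractf)
qed

section \<open>Consequences of vanishing curvature\<close>

context
  assumes flat: "p \<in> S \<Longrightarrow> curv_low f r j h k p = 0"
begin

lemma curv_eq_0:
  assumes "p \<in> S"
  shows "curv f i j h k p = 0"
  using metric_ker[OF assms, where X = "\<lambda>i. curv f i j h k p"] flat[OF assms]
  by (simp add: curv_low_def mult.commute)

text \<open>Under contraction with the fibre coordinate, \<open>conn_L\<close> becomes
  \<open>nonlin_conn\<close> and the \<open>conn_C\<close> term of the curvature drops out by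
  \<open>conn_C_contract\<close>.\<close>

lemma delta_bar_nonlin_conn:
  assumes "p \<in> S"
  shows "delta_bar f h (nonlin_conn f i k) p = 0"
proof -
  have "delta_bar f h (nonlin_conn f i k) p
      = delta_bar f h (\<lambda>q. \<Sum>j\<in>UNIV. snd q $ j * conn_L f i j k q) p"
    unfolding delta_bar_def wirtinger_eqs
    using wirtinger_cong[OF open_S assms conn_L_contract] by simp
  also have "\<dots> = (\<Sum>j\<in>UNIV. snd p $ j * delta_bar f h (conn_L f i j k) p)"
    by (rule delta_bar_sum_coord[OF assms smooth_conn_L])
  also have "\<dots> = - (\<Sum>j\<in>UNIV. \<Sum>l\<in>UNIV.
      delta_bar f h (nonlin_conn f l k) p * (snd p $ j * conn_C f i j l p))"
  proof -
    have "delta_bar f h (conn_L f i j k) p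
        = - (\<Sum>l\<in>UNIV. delta_bar f h (nonlin_conn f l k) p * conn_C f i j l p)" for j
      using curv_eq_0[OF assms, of i j h k] by (simp add: curv_def neg_eq_iff_add_eq_0 eq_neg_iff_add_eq_0)
    then show ?thesis by (simp add: sum_distrib_left sum_negf mult_ac)
  qed
  also have "\<dots> = 0"
    by (subst sum.swap) (simp add: conn_C_contract[OF assms] flip: sum_distrib_left)
  finally show ?thesis .
qed

lemma delta_bar_conn_L:
  assumes "p \<in> S"
  shows "delta_bar f h (conn_L f i j k) p = 0"
  using curv_eq_0[OF assms, of i j h k] by (simp add: curv_def delta_bar_nonlin_conn[OF assms])

text \<open>Obtained by applying the commutator of \<open>d_eta j\<close> and \<open>delta_bar f h\<close> to the nonlinear connection.\<close>

lemma d_etabar_nonlin_conn_product: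
  assumes "p \<in> S"
  shows "(\<Sum>l\<in>UNIV. cnj (d_etabar j (nonlin_conn f l h) p) * d_etabar l (nonlin_conn f i k) p) = 0"
proof -
  let ?N = "nonlin_conn f i k"
  note sm = smooth_wirtinger[OF smooth_nonlin_conn]
    smooth_on_bounded_linear[OF open_S bounded_linear_cnj smooth_nonlin_conn]
  have "0 = d_eta j (\<lambda>q. delta_bar f h ?N q) p"
    using wirtinger_cong[OF open_S assms delta_bar_nonlin_conn] by (simp add: d_eta_eq)
  also have "\<dots> = d_eta j (d_zbar h ?N) p
      - d_eta j (\<lambda>q. \<Sum>l\<in>UNIV. cnj (nonlin_conn f l h q) * d_etabar l ?N q) p"
    unfolding d_eta_eq delta_bar_def
    by (intro wirtinger_diff[OF open_S assms] smooth_on_sum smooth_on_mult sm open_S)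
  also have "d_eta j (\<lambda>q. \<Sum>l\<in>UNIV. cnj (nonlin_conn f l h q) * d_etabar l ?N q) p
      = (\<Sum>l\<in>UNIV. d_eta j (\<lambda>q. cnj (nonlin_conn f l h q) * d_etabar l ?N q) p)"
    unfolding d_eta_eq
    by (intro wirtinger_sum[OF open_S assms] smooth_on_mult sm open_S)
  \<comment> \<open>The first factor is where the conjugate matrix enters: \<open>d_eta j\<close> of
    a conjugate is the conjugate of \<open>d_etabar j\<close>.\<close>
  also have "\<dots> = (\<Sum>l\<in>UNIV. cnj (d_etabar j (nonlin_conn f l h) p) * d_etabar l ?N p
      + cnj (nonlin_conn f l h p) * d_eta j (d_etabar l ?N) p)"
    unfolding d_eta_eq wirtinger_mult[OF open_S assms sm(5,4)]
      wirtinger_cnj[OF open_S assms smooth_nonlin_conn] by (simp add: d_etabar_eq)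
  finally have "d_eta j (d_zbar h ?N) p - (\<Sum>l\<in>UNIV. cnj (nonlin_conn f l h p) * d_eta j (d_etabar l ?N) p)
      = (\<Sum>l\<in>UNIV. cnj (d_etabar j (nonlin_conn f l h) p) * d_etabar l ?N p)"
    by (simp add: sum.distrib algebra_simps)
  \<comment> \<open>After commuting, \<open>d_eta j ?N\<close> may be replaced by
    \<open>conn_L\<close> under both remaining derivatives; the terms then assemble to
    \<open>delta_bar\<close> of \<open>conn_L\<close>, which is zero.\<close>
  moreover have "wirtinger w a b (d_eta j ?N) p = wirtinger w a b (conn_L f i j k) p" for w a b
    by (rule wirtinger_cong[OF open_S assms]) (simp add: conn_L_eq_d_eta_nonlin_conn)
  then have "d_eta j (d_zbar h ?N) p = d_zbar h (conn_L f i j k) p"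
    and "d_eta j (d_etabar l ?N) p = d_etabar l (conn_L f i j k) p" for l
    unfolding wirtinger_eqs by (simp_all add: wirtinger_commute[OF open_S assms smooth_nonlin_conn])
  ultimately show ?thesis
    using delta_bar_conn_L[OF assms, of h i j k] by (simp add: delta_bar_def)
qed

lemma d_etabar_nonlin_conn:
  assumes "p \<in> S"
  shows "d_etabar l (nonlin_conn f i k) p = 0"
proof -
  let ?P = "\<lambda>i l. d_etabar l (nonlin_conn f i k) p"
  have "(\<Sum>i\<in>UNIV. \<Sum>j\<in>UNIV. metric f i j p * ?P i l * cnj (?P j l))
      = (\<Sum>j\<in>UNIV. cnj (?P j l) * (\<Sum>i\<in>UNIV. ?P i l * metric f i j p))"
    unfolding sum_distrib_left by (subst sum.swap) (simp add: mult_ac)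
  \<comment> \<open>Symmetry of the lowered matrix moves \<open>j\<close> from the metric to
    \<open>?P\<close>, so that it can be summed against the conjugate factor.\<close>
  also have "\<dots> = (\<Sum>j\<in>UNIV. cnj (?P j l) * (\<Sum>i\<in>UNIV. ?P i j * metric f i l p))"
    by (subst d_etabar_nonlin_conn_lower_commute[OF assms]) (rule refl)
  also have "\<dots> = (\<Sum>i\<in>UNIV. metric f i l p * (\<Sum>j\<in>UNIV. cnj (?P j l) * ?P i j))"
    unfolding sum_distrib_left by (subst sum.swap) (simp add: mult_ac)
  \<comment> \<open>The inner sum is \<open>d_etabar_nonlin_conn_product\<close> with
    \<open>h\<close> equal to \<open>k\<close>.\<close>
  also have "\<dots> = 0"
    by (simp add: d_etabar_nonlin_conn_product[OF assms])
  finally have "(\<chi> i. ?P i l) = 0"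
    using metric_nondeg[OF assms, of "\<chi> i. ?P i l"] by auto
  then show ?thesis by (simp add: vec_eq_iff)
qed

lemma d_etabar_spray:
  assumes "p \<in> S"
  shows "d_etabar h (spray f i) p = 0"
proof -
  note sm = smooth_on_mult[OF open_S smooth_nonlin_conn smooth_on_snd_nth[OF open_S]]
  have "spray f i = (\<lambda>q. (\<Sum>j\<in>UNIV. nonlin_conn f i j q * snd q $ j) * (1 / 2))"
    by (simp add: spray_def fun_eq_iff)
  then have "d_etabar h (spray f i) p
      = (\<Sum>j\<in>UNIV. d_etabar h (\<lambda>q. nonlin_conn f i j q * snd q $ j) p) * (1 / 2)"
    unfolding d_etabar_eq
    by (simp only: wirtinger_mult[OF open_S assms smooth_on_sum[OF open_S sm] smooth_on_const]
        wirtinger_sum[OF open_S assms sm] wirtinger_const) simp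
  moreover have "d_etabar h (\<lambda>q. nonlin_conn f i j q * snd q $ j) p = 0" for j
    using d_etabar_nonlin_conn[OF assms, of h i j] d_etabar_coord[of h j p]
    unfolding d_etabar_eq
    by (simp add: wirtinger_mult[OF open_S assms smooth_nonlin_conn smooth_on_snd_nth[OF open_S]])
  ultimately show ?thesis by simp
qed

end

end

section \<open>Charts of a complex Finsler space\<close>

lemma complex_manifoldD:
  assumes "complex_manifold M \<A>" "c \<in> \<A>"
  shows "openin M (fst c)" "open (snd c ` fst c)" "inj_on (snd c) (fst c)"
    "homeomorphic_map (subtopology M (fst c)) (top_of_set (snd c ` fst c)) (snd c)"
proof -
  from assms show o: "openin M (fst c)" and "open (snd c ` fst c)"
    and h: "homeomorphic_map (subtopology M (fst c)) (top_of_set (snd c ` fst c)) (snd c)"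
    by (auto simp: complex_manifold_def)
  show "inj_on (snd c) (fst c)"
    using homeomorphic_imp_injective_map[OF h] openin_subset[OF o]
    by (simp add: Int_absorb1)
qed

text \<open>Provides the open set on which identities between transition maps hold, so that their
  derivatives can be compared.\<close>

lemma open_chart_overlap:
  assumes "complex_manifold M \<A>" "c \<in> \<A>" "d \<in> \<A>"
  shows "open (snd c ` (fst c \<inter> fst d))"
proof -
  note c = complex_manifoldD[OF assms(1,2)] and d = complex_manifoldD[OF assms(1,3)]
  have "openin (subtopology M (fst c)) (fst c \<inter> fst d)"
    using d(1) by (auto simp: openin_subtopology)
  then have "openin (top_of_set (snd c ` fst c)) (snd c ` (fst c \<inter> fst d))"
    using homeomorphic_map_openness_eq[OF c(4)] by blast
  then show ?thesis using c(2) openin_open_trans by blast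
qed

section \<open>Transition maps and coordinates of tangent vectors\<close>

lemma transition_chart:
  assumes "complex_manifold M \<A>" "c \<in> \<A>" "q \<in> fst c"
  shows "transition c d (snd c q) = snd d q"
  using complex_manifoldD(3)[OF assms(1,2)] assms(3) by (simp add: transition_def)

lemma transition_deriv:
  assumes "complex_manifold M \<A>" "c \<in> charts_at \<A> p" "d \<in> charts_at \<A> p"
  shows "(transition c d has_derivative transition_deriv c d p) (at (snd c p))"
    and "transition_deriv c d p (a *s v) = a *s transition_deriv c d p v"
proof -
  have "holomorphic_map_on (transition c d) (snd c ` (fst c \<inter> fst d))" "p \<in> fst c \<inter> fst d"
    using assms by (auto simp: complex_manifold_def charts_at_def)
  then obtain D where D: "(transition c d has_derivative D) (at (snd c p))"
    "\<And>c v. D (c *s v) = c *s D v"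
    unfolding holomorphic_map_on_def by blast
  moreover have "transition_deriv c d p = D"
    unfolding transition_deriv_def using frechet_derivative_at[OF D(1)] by simp
  ultimately show "(transition c d has_derivative transition_deriv c d p) (at (snd c p))"
    "transition_deriv c d p (a *s v) = a *s transition_deriv c d p v" by simp_all
qed

text \<open>The cocycle rule is the chain rule: on the image of the overlap of \<open>c\<close> and
  \<open>d\<close>, \<open>transition c e\<close> equals the composite through
  \<open>d\<close>.\<close>

lemma transition_deriv_trans:
  assumes M: "complex_manifold M \<A>"
    and "c \<in> charts_at \<A> p" "d \<in> charts_at \<A> p" "e \<in> charts_at \<A> p"
  shows "transition_deriv c e p v = transition_deriv d e p (transition_deriv c d p v)"
proof -
  have p: "c \<in> \<A>" "d \<in> \<A>" "p \<in> fst c" "p \<in> fst d"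
    using assms by (auto simp: charts_at_def)
  note tr = transition_chart[OF M p(1)] transition_chart[OF M p(2)]
  have "(transition d e has_derivative transition_deriv d e p) (at (transition c d (snd c p)))"
    using transition_deriv(1)[OF M assms(3,4)] p by (simp add: tr)
  from has_derivative_compose[OF transition_deriv(1)[OF M assms(2,3)] this]
  have "((\<lambda>x. transition d e (transition c d x)) has_derivative
      (\<lambda>v. transition_deriv d e p (transition_deriv c d p v))) (at (snd c p))" .
  then have "(transition c e has_derivative
      (\<lambda>v. transition_deriv d e p (transition_deriv c d p v))) (at (snd c p))"
    by (rule has_derivative_transform_within_open[OF _ open_chart_overlap[OF M p(1,2)]])
      (use p in \<open>auto simp: tr\<close>)
  from has_derivative_unique[OF transition_deriv(1)[OF M assms(2,4)] this]
  show ?thesis by (simp add: fun_eq_iff)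
qed

text \<open>The compatibility condition of \<open>tangent_space\<close> is exactly the cocycle
  rule.\<close>

lemma tvec_of_coords_in_tangent_space:
  assumes "complex_manifold M \<A>" "c \<in> charts_at \<A> p"
  shows "tvec_of_coords \<A> c p \<eta> \<in> tangent_space \<A> p"
  by (auto simp: tangent_space_def tvec_of_coords_def intro: transition_deriv_trans[OF assms])

lemma tvec_of_coords_scale:
  assumes "complex_manifold M \<A>" "c \<in> charts_at \<A> p"
  shows "tvec_of_coords \<A> c p (a *s \<eta>) = tvec_scale \<A> p a (tvec_of_coords \<A> c p \<eta>)"
  using transition_deriv(2)[OF assms]
  by (auto simp: tvec_of_coords_def tvec_scale_def fun_eq_iff)

text \<open>Homogeneity is given for tangent vectors; it passes to coordinates because
  \<open>tvec_of_coords\<close> commutes with scaling, by complex linearity of the transition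
  derivatives.\<close>

lemma finsler_chart_in_chart:
  assumes F: "complex_finsler_space M \<A> F" and c: "c \<in> \<A>"
  shows "finsler_chart (in_chart \<A> F c) (slit_dom c)"
proof
  have M: "complex_manifold M \<A>" using F by (simp add: complex_finsler_space_def)
  show "open (slit_dom c)"
    unfolding slit_dom_def by (intro open_Times complex_manifoldD(2)[OF M c]) auto
  show "smooth_on (\<lambda>p. (in_chart \<A> F c p)\<^sup>2) (slit_dom c)"
    using F c by (simp add: complex_finsler_space_def)
  show "in_chart \<A> F c (z, l *s \<eta>) = cmod l * in_chart \<A> F c (z, \<eta>)"
    if z: "(z, \<eta>) \<in> slit_dom c" for z \<eta> l
  proof -
    obtain p where p: "p \<in> fst c" "z = snd c p" using z by (auto simp: slit_dom_def)
    then have "inv_into (fst c) (snd c) z = p"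
      using complex_manifoldD(3)[OF M c] by simp
    moreover have "p \<in> topspace M"
      using p openin_subset[OF complex_manifoldD(1)[OF M c]] by auto
    moreover have "c \<in> charts_at \<A> p" using c p by (simp add: charts_at_def)
    moreover have "F p (tvec_scale \<A> p l v) = cmod l * F p v"
      if "p \<in> topspace M" "v \<in> tangent_space \<A> p" for v
      using F that unfolding complex_finsler_space_def by blast
    ultimately show ?thesis
      using tvec_of_coords_in_tangent_space[OF M, of c p \<eta>] tvec_of_coords_scale[OF M, of c p l \<eta>]
      by (simp add: in_chart_def)
  qed
  show "(\<Sum>i\<in>UNIV. \<Sum>j\<in>UNIV. metric (in_chart \<A> F c) i j q * \<zeta> $ i * cnj (\<zeta> $ j)) \<noteq> 0"
    if "q \<in> slit_dom c" "\<zeta> \<noteq> 0" for q \<zeta>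
  proof -
    let ?s = "\<Sum>i\<in>UNIV. \<Sum>j\<in>UNIV. metric (in_chart \<A> F c) i j q * \<zeta> $ i * cnj (\<zeta> $ j)"
    have "0 < Re ?s"
      using F c that unfolding complex_finsler_space_def Let_def by blast
    then show ?thesis by force
  qed
qed

theorem theorem4p15:
  fixes M :: "'a topology"
    and \<A> :: "('a, 2) chart set"
    and F :: "'a \<Rightarrow> ('a, 2) tvec \<Rightarrow> real"
  assumes "complex_finsler_space M \<A> F"
    and "connected_space M"
    and "\<forall>c\<in>\<A>. \<forall>q\<in>slit_dom c. \<forall>r j h k. curv_low (in_chart \<A> F c) r j h k q = 0"
    and "\<exists>c\<in>\<A>. \<exists>q\<in>slit_dom c. cmod (A_coef (in_chart \<A> F c) q) \<noteq> 0"
  shows "\<forall>c\<in>\<A>. \<forall>q\<in>slit_dom c. \<forall>i h. d_etabar h (spray (in_chart \<A> F c) i) q = 0"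
proof (intro ballI allI)
  fix c q i h
  assume c: "c \<in> \<A>" and q: "q \<in> slit_dom c"
  interpret finsler_chart "in_chart \<A> F c" "slit_dom c"
    by (rule finsler_chart_in_chart[OF assms(1) c])
  show "d_etabar h (spray (in_chart \<A> F c) i) q = 0"
    \<comment> \<open>Outside its context, \<open>d_etabar_spray\<close> has the flatness assumption
      as first premise.\<close>
    by (rule d_etabar_spray[OF _ q]) (use assms(3) c in blast)
qed

end
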